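(* Let $d\ge1$ and let $\{(X_n,Y_n)\}_{n\in\mathbb Z}$ be a doubly infinite stationary and ergodic process with $X_n\in\mathbb R^d$ and $Y_n\in\{0,1\}$. Let $\mathcal D^-=(X_{-\infty}^{-1},Y_{-\infty}^{-1})$, let $g^*$ be the Bayes decision, and let $\eta_k$ and $g_k$ be the estimators and decision rules constructed as described in the context. Then, as $k\to\infty$, $$P(g_k\ne Y_0\mid X_0,\mathcal D^-)\to P(g^*(X_0,\mathcal D^-)\ne Y_0\mid X_0,\mathcal D^-)\quad\text{a.s.}$$
   Context: Notation: for $i\le j$, $X_i^j=(X_i,\dots,X_j)$ and $Y_i^j=(Y_i,\dots,Y_j)$; $X_{-\infty}^{-1}$ and $Y_{-\infty}^{-1}$ denote the infinite pasts. Bayes decision: $\eta(X_0,\mathcal D^-)=P(Y_0=1\mid X_0,\mathcal D^-)=E(Y_0\mid X_0,\mathcal D^-)$, and $g^*(X_0,\mathcal D^-)=1$ if $\eta(X_0,\mathcal D^-)\ge1/2$ and $0$ otherwise. Partitions and quantizers: $\mathcal P_k=\{A_{k,i}: i=1,\dots,m_k\}$, $k\ge1$, is a sequence of finite partitions of $\mathbb R^d$ into rectangles (products of $d$ finite or infinite right semi-closed intervals) such that the finite $\sigma$-algebras $\sigma(\mathcal P_k)$ are increasing in $k$ and asymptotically generate the Borel $\sigma$-field of $\mathbb R^d$ (i.e. $\bigcup_k\sigma(\mathcal P_k)$ generates it). The quantizer $G_k$ is defined by $G_k(x)=A_{k,i}$ if $x\in A_{k,i}$, and it is applied termwise to finite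 sequences of points of $\mathbb R^d$. Recursive construction: put $\lambda_0=1$, and for $k=1,2,\dots$ let $$\tau_k=\min\{t>0:\ G_k(X_{-\lambda_{k-1}-t}^{-t})=G_k(X_{-\lambda_{k-1}}^{0}),\ \ Y_{-\lambda_{k-1}-t}^{-1-t}=Y_{-\lambda_{k-1}}^{-1}\},\qquad \lambda_k=\tau_k+\lambda_{k-1}.$$ Here $t$ ranges over positive integers; by ergodicity all $\tau_k$ are a.s. finite. Estimators: $\eta_k=\frac1k\sum_{1\le j\le k}Y_{-\tau_j}$, and $g_k=g_k(X_0,\mathcal D^-)=1$ if $\eta_k\ge1/2$ and $0$ otherwise. *)

theory Defs
  imports "HOL-Probability.Probability"
begin

definition path_law :: "'w measure \<Rightarrow> 's measure \<Rightarrow> (int \<Rightarrow> 'w \<Rightarrow> 's) \<Rightarrow> (int \<Rightarrow> 's) measure" where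
  "path_law M S Z = distr M (\<Pi>\<^sub>M n\<in>UNIV. S) (\<lambda>\<omega> n. Z n \<omega>)"

definition shift :: "(int \<Rightarrow> 's) \<Rightarrow> (int \<Rightarrow> 's)" where
  "shift z = (\<lambda>n. z (n + 1))"

definition stationary_process :: "'w measure \<Rightarrow> 's measure \<Rightarrow> (int \<Rightarrow> 'w \<Rightarrow> 's) \<Rightarrow> bool" where
  "stationary_process M S Z \<longleftrightarrow>
     (\<forall>n. Z n \<in> M \<rightarrow>\<^sub>M S) \<and>
     distr (path_law M S Z) (\<Pi>\<^sub>M n\<in>UNIV. S) shift = path_law M S Z"

definition ergodic_process :: "'w measure \<Rightarrow> 's measure \<Rightarrow> (int \<Rightarrow> 'w \<Rightarrow> 's) \<Rightarrow> bool" where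
  "ergodic_process M S Z \<longleftrightarrow>
     (\<forall>A \<in> sets (path_law M S Z).
        shift -` A \<inter> space (path_law M S Z) = A \<longrightarrow>
        measure (path_law M S Z) A \<in> {0, 1})"

text \<open>With extended real endpoints, the condition \<open>a i < x $ i \<le> b i\<close> covers the right
  semi-closed intervals \<open>(a, b]\<close>, \<open>(-\<infinity>, b]\<close>, \<open>(a, \<infinity>)\<close> and \<open>(-\<infinity>, \<infinity>)\<close>.\<close>

definition rectangle :: "(real ^ 'd) set \<Rightarrow> bool" where
  "rectangle A \<longleftrightarrow>
     (\<exists>a b :: 'd \<Rightarrow> ereal. A = {x. \<forall>i. a i < ereal (x $ i) \<and> ereal (x $ i) \<le> b i})"

text \<open>Partitions are indexed by \<open>k \<ge> 1\<close>; the value at \<open>0\<close> is never used.\<close>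

definition rectangle_partitions :: "(nat \<Rightarrow> (real ^ 'd) set set) \<Rightarrow> bool" where
  "rectangle_partitions \<P> \<longleftrightarrow>
     (\<forall>k\<ge>1. finite (\<P> k) \<and> partition_on UNIV (\<P> k) \<and> (\<forall>A\<in>\<P> k. rectangle A)) \<and>
     (\<forall>k\<ge>1. sigma_sets UNIV (\<P> k) \<subseteq> sigma_sets UNIV (\<P> (Suc k))) \<and>
     sigma_sets UNIV (\<Union>k\<in>{1..}. sigma_sets UNIV (\<P> k)) = sets borel"

definition quantizer :: "'x set set \<Rightarrow> 'x \<Rightarrow> 'x set" where
  "quantizer P x = (THE A. A \<in> P \<and> x \<in> A)"

definition segment :: "(int \<Rightarrow> 'z) \<Rightarrow> int \<Rightarrow> int \<Rightarrow> 'z list" where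
  "segment z i j = map z [i..j]"

text \<open>The following notions are functions of a single trajectory \<open>(x, y)\<close>. The value of
  \<open>recurrence_time\<close> is arbitrary when the pattern does not recur, which for
  a stationary process is an event of probability zero.\<close>

definition recurrence_time ::
    "'x set set \<Rightarrow> (int \<Rightarrow> 'x) \<Rightarrow> (int \<Rightarrow> nat) \<Rightarrow> nat \<Rightarrow> nat" where
  "recurrence_time P x y l = (LEAST t. t > 0 \<and>
     map (quantizer P) (segment x (- int l - int t) (- int t)) =
       map (quantizer P) (segment x (- int l) 0) \<and>
     segment y (- int l - int t) (- 1 - int t) = segment y (- int l) (- 1))"

primrec lambda_seq ::
    "(nat \<Rightarrow> 'x set set) \<Rightarrow> (int \<Rightarrow> 'x) \<Rightarrow> (int \<Rightarrow> nat) \<Rightarrow> nat \<Rightarrow> nat" where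
  "lambda_seq \<P> x y 0 = 1"
| "lambda_seq \<P> x y (Suc k) =
     recurrence_time (\<P> (Suc k)) x y (lambda_seq \<P> x y k) + lambda_seq \<P> x y k"

text \<open>Meaningful for \<open>k \<ge> 1\<close> only.\<close>

definition tau_seq ::
    "(nat \<Rightarrow> 'x set set) \<Rightarrow> (int \<Rightarrow> 'x) \<Rightarrow> (int \<Rightarrow> nat) \<Rightarrow> nat \<Rightarrow> nat" where
  "tau_seq \<P> x y k = recurrence_time (\<P> k) x y (lambda_seq \<P> x y (k - 1))"

definition eta_est ::
    "(nat \<Rightarrow> 'x set set) \<Rightarrow> (int \<Rightarrow> 'x) \<Rightarrow> (int \<Rightarrow> nat) \<Rightarrow> nat \<Rightarrow> real" where
  "eta_est \<P> x y k = 1 / real k * (\<Sum>j=1..k. real (y (- int (tau_seq \<P> x y j))))"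

definition g_est ::
    "(nat \<Rightarrow> 'x set set) \<Rightarrow> (int \<Rightarrow> 'x) \<Rightarrow> (int \<Rightarrow> nat) \<Rightarrow> nat \<Rightarrow> nat" where
  "g_est \<P> x y k = (if eta_est \<P> x y k \<ge> 1 / 2 then 1 else 0)"

abbreviation obs_space :: "('x::topological_space \<times> nat) measure" where
  "obs_space \<equiv> borel \<Otimes>\<^sub>M count_space {0, 1}"

text \<open>The sub-\<open>\<sigma>\<close>-algebra of \<open>M\<close> generated by \<open>X\<^sub>0\<close> together with the infinite past
  of both coordinates.\<close>

definition past_algebra ::
    "'w measure \<Rightarrow> (int \<Rightarrow> 'w \<Rightarrow> 'x::topological_space) \<Rightarrow> (int \<Rightarrow> 'w \<Rightarrow> nat) \<Rightarrow> 'w measure" where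
  "past_algebra M X Y =
     vimage_algebra (space M) (\<lambda>\<omega>. (X 0 \<omega>, \<lambda>n\<in>{..<0}. (X n \<omega>, Y n \<omega>)))
       (borel \<Otimes>\<^sub>M (\<Pi>\<^sub>M n\<in>{..<0}. obs_space))"

definition prob_given :: "'w measure \<Rightarrow> 'w measure \<Rightarrow> ('w \<Rightarrow> bool) \<Rightarrow> 'w \<Rightarrow> real" where
  "prob_given M F Q = real_cond_exp M F (indicator {\<omega> \<in> space M. Q \<omega>})"

definition bayes_decision ::
    "'w measure \<Rightarrow> (int \<Rightarrow> 'w \<Rightarrow> 'x::topological_space) \<Rightarrow> (int \<Rightarrow> 'w \<Rightarrow> nat) \<Rightarrow> 'w \<Rightarrow> nat" where
  "bayes_decision M X Y \<omega> =
     (if prob_given M (past_algebra M X Y) (\<lambda>\<omega>. Y 0 \<omega> = 1) \<omega> \<ge> 1 / 2 then 1 else 0)"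

end

theory Submission
  imports Defs "HOL-Library.Discrete_Functions"
begin

text \<open>
  Write \<open>\<eta>\<close> for the conditional probability of \<open>Y\<^sub>0 = 1\<close> given \<open>X\<^sub>0\<close> and the past. A decision rule
  \<open>g\<close> that depends on these only has conditional error probability \<open>1 - \<eta>\<close> where it says 1
  and \<open>\<eta>\<close> where it says 0 (\<open>cond_error_prob\<close>). Hence it suffices that the estimates \<open>\<eta>\<^sub>k\<close> converge to
  \<open>\<eta>\<close> almost surely: where \<open>\<eta> \<noteq> 1/2\<close>, the rule \<open>g\<^sub>k\<close> eventually equals the Bayes decision, and where
  \<open>\<eta> = 1/2\<close> both decisions have conditional error \<open>1/2\<close>, so oscillations of \<open>g\<^sub>k\<close> do no harm.

  The convergence \<open>\<eta>\<^sub>k \<rightarrow> \<eta>\<close> rests on one consequence of stationarity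
  (\<open>prob_at_backward_return\<close>). Let \<open>E\<close> be an event about the trajectory seen from time 0, and let
  \<open>\<tau>\<close> be the least \<open>t > 0\<close> such that \<open>E\<close> also holds seen from time \<open>-t\<close>. Shifting
  by \<open>t\<close> turns the pair (\<open>E\<close> now, previous occurrence of \<open>E\<close> at time \<open>-t\<close>) into
  the pair (\<open>E\<close> now, next occurrence of \<open>E\<close> at time \<open>t\<close>). By Poincare recurrence almost every
  occurrence of \<open>E\<close> has a next and a previous one, so that, summing over \<open>t\<close>, the trajectory
  seen from \<open>-\<tau>\<close> has on \<open>E\<close> the same law as the one seen from 0.

  Let \<open>F\<^sub>n\<close> be generated by the quantized pattern on \<open>[-\<lambda>\<^sub>n, 0]\<close> that determines
  \<open>\<tau>\<^sub>n\<^sub>+\<^sub>1\<close>. Since this pattern determines \<open>\<lambda>\<^sub>n\<close> and all earlier patterns (\<open>lam_determined\<close>),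
  the \<open>F\<^sub>n\<close> increase, and every atom of \<open>F\<^sub>n\<close> is, up to null sets, an event \<open>E\<close> as above.
  Therefore \<open>Y\<close> at time \<open>-\<tau>\<^sub>n\<^sub>+\<^sub>1\<close> and \<open>Y\<^sub>0\<close> have the same conditional
  expectation given \<open>F\<^sub>n\<close> (\<open>cond_exp_matched_label\<close>), and
  \<open>\<eta>\<^sub>k\<close> splits into two means over \<open>n < k\<close>. The first is a mean of bounded martingale differences
  and tends to 0 by a strong law of large numbers (\<open>orthogonal_strong_law\<close>). The second is the
  mean of the conditional probabilities of \<open>Y\<^sub>0 = 1\<close> given \<open>F\<^sub>n\<close>. As \<open>\<lambda>\<^sub>n \<rightarrow> \<infinity>\<close> and
  the partitions generate the Borel sets, the \<open>F\<^sub>n\<close> exhaust \<open>X\<^sub>0\<close> and the past up to null sets, and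
  Levy's upward theorem (\<open>levy_upward\<close>) gives the limit \<open>\<eta>\<close>.
\<close>

section \<open>Cesaro means and a law of large numbers\<close>

lemma cesaro_mean_tendsto:
  fixes a :: "nat \<Rightarrow> real"
  assumes "a \<longlonglongrightarrow> L"
  shows "(\<lambda>n. (\<Sum>i<n. a i) / real n) \<longlonglongrightarrow> L"
proof (rule LIMSEQ_I)
  fix e :: real assume "0 < e"
  then have "0 < e / 2" by simp
  from LIMSEQ_D[OF assms this] obtain N where N: "\<And>i. i \<ge> N \<Longrightarrow> \<bar>a i - L\<bar> < e / 2"
    by auto
  define C where "C = (\<Sum>i<N. \<bar>a i - L\<bar>)"
  obtain K :: nat where K: "real K > 2 * C / e"
    using reals_Archimedean2 by blast
  have "norm ((\<Sum>i<n. a i) / real n - L) < e" if n: "n \<ge> max (Suc N) K" for n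
  proof -
    have pos: "0 < real n" using n by simp
    have "{..<n} = {..<N} \<union> {N..<n}" using n by auto
    then have split: "(\<Sum>i<n. \<bar>a i - L\<bar>) = C + (\<Sum>i\<in>{N..<n}. \<bar>a i - L\<bar>)"
      unfolding C_def by (simp add: sum.union_disjoint ivl_disj_int)
    have "(\<Sum>i\<in>{N..<n}. \<bar>a i - L\<bar>) \<le> (\<Sum>i\<in>{N..<n}. e / 2)"
      by (rule sum_mono, rule less_imp_le, rule N) simp
    also have "\<dots> \<le> real n * (e / 2)"
      using \<open>0 < e\<close> by simp
    finally have tail: "(\<Sum>i\<in>{N..<n}. \<bar>a i - L\<bar>) \<le> real n * (e / 2)" .
    have "2 * C / e < real n"
      using K n by linarith
    then have head: "C < real n * (e / 2)"
      using \<open>0 < e\<close> by (simp add: field_simps)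
    have "(\<Sum>i<n. a i) / real n - L = (\<Sum>i<n. a i - L) / real n"
      using pos by (simp add: sum_subtractf field_simps)
    then have "norm ((\<Sum>i<n. a i) / real n - L) = \<bar>\<Sum>i<n. a i - L\<bar> / real n"
      by simp
    also have "\<dots> \<le> (\<Sum>i<n. \<bar>a i - L\<bar>) / real n"
      by (intro divide_right_mono sum_abs) simp
    also have "\<dots> < (real n * e) / real n"
      using split tail head pos by (intro divide_strict_right_mono) auto
    finally show ?thesis
      using pos by simp
  qed
  then show "\<exists>no. \<forall>n\<ge>no. norm ((\<Sum>i<n. a i) / real n - L) < e"
    by blast
qed

text \<open>Between two consecutive squares \<open>r\<^sup>2 \<le> n < (r + 1)\<^sup>2\<close> the partial sums move by at most \<open>2 r\<close>,
  which is negligible against \<open>n\<close>. Along squares the second-moment bounds of the strong law below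
  become summable.\<close>

lemma cesaro_zero_from_squares:
  fixes d :: "nat \<Rightarrow> real"
  assumes bound: "\<And>i. \<bar>d i\<bar> \<le> 1"
    and squares: "(\<lambda>r. (\<Sum>i<r\<^sup>2. d i) / real (r\<^sup>2)) \<longlonglongrightarrow> 0"
  shows "(\<lambda>n. (\<Sum>i<n. d i) / real n) \<longlonglongrightarrow> 0"
proof -
  have at_top: "filterlim floor_sqrt at_top sequentially"
    unfolding filterlim_at_top
    by (metis (mono_tags, lifting) eventually_sequentiallyI le_floor_sqrtI)
  define u where "u r = \<bar>(\<Sum>i<r\<^sup>2. d i) / real (r\<^sup>2)\<bar> + 2 / real r" for r
  have "u \<longlonglongrightarrow> 0 + 0"
    unfolding u_def
    by (intro tendsto_add tendsto_rabs_zero squares lim_const_over_n)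
  then have "(\<lambda>n. u (floor_sqrt n)) \<longlonglongrightarrow> 0"
    using filterlim_compose[OF _ at_top, of u] by simp
  moreover have "norm ((\<Sum>i<n. d i) / real n) \<le> u (floor_sqrt n)" if "n \<ge> 1" for n
  proof -
    define r where "r = floor_sqrt n"
    have r: "r \<ge> 1" "r\<^sup>2 \<le> n"
      using that by (auto simp: r_def Suc_le_eq)
    have "n < (Suc r)\<^sup>2"
      unfolding r_def by (rule Suc_floor_sqrt_power2_gt)
    then have gap: "n - r\<^sup>2 \<le> 2 * r"
      by (simp add: power2_eq_square)
    have "{..<n} = {..<r\<^sup>2} \<union> {r\<^sup>2..<n}"
      using r by auto
    then have split: "(\<Sum>i<n. d i) = (\<Sum>i<r\<^sup>2. d i) + (\<Sum>i\<in>{r\<^sup>2..<n}. d i)"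
      by (simp add: sum.union_disjoint ivl_disj_int)
    have "\<bar>\<Sum>i\<in>{r\<^sup>2..<n}. d i\<bar> \<le> (\<Sum>i\<in>{r\<^sup>2..<n}. 1)"
      by (rule order_trans[OF sum_abs]) (intro sum_mono bound)
    also have "\<dots> = real (n - r\<^sup>2)"
      by simp
    also have "\<dots> \<le> 2 * real r"
      using gap by (metis of_nat_le_iff of_nat_mult of_nat_numeral)
    finally have tail: "\<bar>\<Sum>i\<in>{r\<^sup>2..<n}. d i\<bar> \<le> 2 * real r" .
    have pos: "0 < real (r\<^sup>2)"
      using r(1) by simp
    have le: "real (r\<^sup>2) \<le> real n"
      using r(2) by (simp only: of_nat_le_iff)
    have "norm ((\<Sum>i<n. d i) / real n) = \<bar>\<Sum>i<n. d i\<bar> / real n"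
      by simp
    also have "\<dots> \<le> \<bar>\<Sum>i<n. d i\<bar> / real (r\<^sup>2)"
      using pos le by (intro divide_left_mono[OF le] mult_pos_pos) linarith+
    also have "\<dots> \<le> (\<bar>\<Sum>i<r\<^sup>2. d i\<bar> + 2 * real r) / real (r\<^sup>2)"
      using tail pos unfolding split by (intro divide_right_mono) linarith+
    also have "\<dots> = u r"
      using r by (simp add: u_def add_divide_distrib power2_eq_square)
    finally show ?thesis
      by (simp add: r_def)
  qed
  then have "\<forall>\<^sub>F n in sequentially. norm ((\<Sum>i<n. d i) / real n) \<le> u (floor_sqrt n)"
    by (rule eventually_sequentiallyI[of 1])
  ultimately show ?thesis
    by (rule Lim_null_comparison[rotated])
qed

lemma (in prob_space) orthogonal_sum_second_moment:
  fixes d :: "nat \<Rightarrow> 'a \<Rightarrow> real"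
  assumes [measurable]: "\<And>n. d n \<in> borel_measurable M"
    and bound: "\<And>n. AE \<omega> in M. \<bar>d n \<omega>\<bar> \<le> 1"
    and orthogonal: "\<And>m n. m < n \<Longrightarrow> expectation (\<lambda>\<omega>. d m \<omega> * d n \<omega>) = 0"
  shows "integrable M (\<lambda>\<omega>. (\<Sum>i<n. d i \<omega>)\<^sup>2)"
    and "expectation (\<lambda>\<omega>. (\<Sum>i<n. d i \<omega>)\<^sup>2) \<le> real n"
proof -
  have int_prod: "integrable M (\<lambda>\<omega>. d i \<omega> * d j \<omega>)" for i j
  proof (rule integrable_const_bound[of _ 1])
    show "AE \<omega> in M. norm (d i \<omega> * d j \<omega>) \<le> 1"
      using bound[of i] bound[of j] by eventually_elim (simp add: abs_mult mult_le_one)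
  qed simp
  have expand: "(\<Sum>i<Suc n. d i \<omega>)\<^sup>2
      = (\<Sum>i<n. d i \<omega>)\<^sup>2 + (2 * (\<Sum>i<n. d i \<omega> * d n \<omega>) + d n \<omega> * d n \<omega>)" for n \<omega>
    by (simp add: power2_sum sum_distrib_right[symmetric] mult.commute power2_eq_square algebra_simps)
  have int_cross: "integrable M (\<lambda>\<omega>. \<Sum>i<n. d i \<omega> * d n \<omega>)" for n
    by (intro Bochner_Integration.integrable_sum int_prod)
  have sq_le: "expectation (\<lambda>\<omega>. d n \<omega> * d n \<omega>) \<le> 1" for n
  proof -
    have "expectation (\<lambda>\<omega>. d n \<omega> * d n \<omega>) \<le> expectation (\<lambda>_. 1)"
      using bound[of n]
      by (intro integral_mono_AE int_prod) (auto elim!: eventually_mono simp: abs_square_le_1[unfolded power2_eq_square] abs_le_square_iff)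
    then show ?thesis
      by (simp add: prob_space)
  qed
  have "integrable M (\<lambda>\<omega>. (\<Sum>i<n. d i \<omega>)\<^sup>2) \<and> expectation (\<lambda>\<omega>. (\<Sum>i<n. d i \<omega>)\<^sup>2) \<le> real n"
  proof (induction n)
    case 0
    then show ?case by simp
  next
    case (Suc n)
    have cross: "expectation (\<lambda>\<omega>. \<Sum>i<n. d i \<omega> * d n \<omega>) = 0"
      by (subst Bochner_Integration.integral_sum) (auto simp: int_prod orthogonal)
    show ?case
      unfolding expand using Suc sq_le[of n] cross
      by (simp add: int_cross int_prod)
  qed
  then show "integrable M (\<lambda>\<omega>. (\<Sum>i<n. d i \<omega>)\<^sup>2)"
    and "expectation (\<lambda>\<omega>. (\<Sum>i<n. d i \<omega>)\<^sup>2) \<le> real n"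
    by auto
qed

text \<open>Orthogonality bounds the second moment of the \<open>n\<close>-th mean by \<open>1 / n\<close>. This is summable along
  \<open>n = r\<^sup>2\<close>, so the squared means have an almost surely finite sum over these \<open>n\<close> and tend to 0
  there.\<close>

lemma (in prob_space) orthogonal_strong_law:
  fixes d :: "nat \<Rightarrow> 'a \<Rightarrow> real"
  assumes [measurable]: "\<And>n. d n \<in> borel_measurable M"
    and bound: "\<And>n. AE \<omega> in M. \<bar>d n \<omega>\<bar> \<le> 1"
    and orthogonal: "\<And>m n. m < n \<Longrightarrow> expectation (\<lambda>\<omega>. d m \<omega> * d n \<omega>) = 0"
  shows "AE \<omega> in M. (\<lambda>n. (\<Sum>i<n. d i \<omega>) / real n) \<longlonglongrightarrow> 0"
proof -
  define a where "a r \<omega> = ((\<Sum>i<r\<^sup>2. d i \<omega>) / real (r\<^sup>2))\<^sup>2" for r \<omega>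
  have [measurable]: "a r \<in> borel_measurable M" for r
    unfolding a_def by simp
  note moment = orthogonal_sum_second_moment[OF assms]
  have int_a: "integrable M (a r)" for r
    using moment(1)[where n = "r\<^sup>2"] unfolding a_def by (simp add: power_divide)
  have "expectation (a r) \<le> 1 / real (r\<^sup>2)" for r
  proof (cases "r = 0")
    case False
    have "expectation (a r) = expectation (\<lambda>\<omega>. (\<Sum>i<r\<^sup>2. d i \<omega>)\<^sup>2) / (real (r\<^sup>2))\<^sup>2"
      unfolding a_def by (simp add: power_divide)
    also have "\<dots> \<le> real (r\<^sup>2) / (real (r\<^sup>2))\<^sup>2"
      using moment(2)[where n = "r\<^sup>2"] by (intro divide_right_mono) auto
    finally show ?thesis
      using False by (simp add: power2_eq_square)
  qed (simp add: a_def[abs_def])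
  then have nn_le: "(\<integral>\<^sup>+\<omega>. ennreal (a r \<omega>) \<partial>M) \<le> ennreal (1 / real (r\<^sup>2))" for r
    by (subst nn_integral_eq_integral[OF int_a]) (auto simp: a_def intro!: ennreal_leI)
  have summable_inv: "summable (\<lambda>r. 1 / real (r\<^sup>2))"
    using inverse_power_summable[of 2, where ?'a = real] by (simp add: field_simps)
  have "(\<integral>\<^sup>+\<omega>. (\<Sum>r. ennreal (a r \<omega>)) \<partial>M) = (\<Sum>r. \<integral>\<^sup>+\<omega>. ennreal (a r \<omega>) \<partial>M)"
    by (rule nn_integral_suminf) simp
  also have "\<dots> \<le> (\<Sum>r. ennreal (1 / real (r\<^sup>2)))"
    by (intro suminf_le nn_le) auto
  also have "\<dots> < \<infinity>"
    using summable_inv by (subst suminf_ennreal2) auto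
  finally have "(\<integral>\<^sup>+\<omega>. (\<Sum>r. ennreal (a r \<omega>)) \<partial>M) \<noteq> \<infinity>"
    by simp
  then have "AE \<omega> in M. (\<Sum>r. ennreal (a r \<omega>)) \<noteq> \<infinity>"
    by (rule nn_integral_PInf_AE[rotated]) simp
  then have squares: "AE \<omega> in M. (\<lambda>r. (\<Sum>i<r\<^sup>2. d i \<omega>) / real (r\<^sup>2)) \<longlonglongrightarrow> 0"
  proof eventually_elim
    case (elim \<omega>)
    then have "summable (\<lambda>r. a r \<omega>)"
      by (intro summable_suminf_not_top) (auto simp: a_def)
    then have "(\<lambda>r. a r \<omega>) \<longlonglongrightarrow> 0"
      by (rule summable_LIMSEQ_zero)
    then have "(\<lambda>r. sqrt (a r \<omega>)) \<longlonglongrightarrow> sqrt 0"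
      by (rule tendsto_real_sqrt)
    then have "(\<lambda>r. \<bar>(\<Sum>i<r\<^sup>2. d i \<omega>) / real (r\<^sup>2)\<bar>) \<longlonglongrightarrow> 0"
      unfolding a_def by (simp only: real_sqrt_abs real_sqrt_zero)
    then show ?case
      by (rule tendsto_rabs_zero_cancel)
  qed
  moreover have "AE \<omega> in M. \<forall>i. \<bar>d i \<omega>\<bar> \<le> 1"
    using bound by (simp add: AE_all_countable)
  ultimately show ?thesis
    by eventually_elim (rule cesaro_zero_from_squares, auto)
qed

section \<open>Upward martingale convergence\<close>

lemma (in prob_space) sigma_finite_subalgebraI:
  assumes "subalgebra M F"
  shows "sigma_finite_subalgebra M F"
  by (intro finite_measure_subalgebra_is_sigma_finite)
     (simp add: finite_measure_subalgebra_def finite_measure_subalgebra_axioms_def assms finite_measure_axioms)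

locale prob_filtration = prob_space M for M :: "'a measure" +
  fixes F :: "nat \<Rightarrow> 'a measure"
  assumes sub_F: "\<And>n. subalgebra M (F n)"
    and F_mono: "\<And>m n. m \<le> n \<Longrightarrow> sets (F m) \<subseteq> sets (F n)"
begin

text \<open>Decompose by the first time \<open>n\<close> at which the martingale exceeds \<open>a\<close>. That event lies in \<open>F n\<close>,
  so on it the conditional expectation may be replaced by \<open>h\<close> under the integral.\<close>

lemma doob_maximal_inequality:
  fixes h :: "'a \<Rightarrow> real"
  assumes h[measurable]: "integrable M h" and nonneg: "\<And>\<omega>. 0 \<le> h \<omega>"
    and a: "0 < a"
  shows "prob {\<omega>\<in>space M. \<exists>n. real_cond_exp M (F n) h \<omega> > a} \<le> expectation h / a"
proof -
  define C where "C n = real_cond_exp M (F n) h" for n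
  have C_meas: "C i \<in> borel_measurable (F n)" if "i \<le> n" for i n
  proof -
    have "subalgebra (F n) (F i)"
      using F_mono[OF that] sub_F by (simp add: subalgebra_def)
    then show ?thesis
      unfolding C_def by (rule measurable_from_subalg) simp
  qed
  define A where "A n = {\<omega>\<in>space M. C n \<omega> > a \<and> (\<forall>i<n. \<not> C i \<omega> > a)}" for n
  have AF: "A n \<in> sets (F n)" for n
  proof -
    have level: "{\<omega>\<in>space (F n). C i \<omega> > a} \<in> sets (F n)" if "i \<le> n" for i
      using C_meas[OF that] by measurable
    have "{\<omega>\<in>space (F n). C n \<omega> > a} - (\<Union>i<n. {\<omega>\<in>space (F n). C i \<omega> > a}) \<in> sets (F n)"
      by (intro sets.Diff sets.finite_UN level) auto
    also have "{\<omega>\<in>space (F n). C n \<omega> > a} - (\<Union>i<n. {\<omega>\<in>space (F n). C i \<omega> > a}) = A n"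
      using sub_F[of n] by (auto simp: A_def subalgebra_def)
    finally show ?thesis .
  qed
  have A_M[measurable]: "A n \<in> sets M" for n
    using AF[of n] sub_F[of n] by (auto simp: subalgebra_def)
  have int_Ah: "integrable M (\<lambda>\<omega>. indicator (A n) \<omega> * h \<omega>)" for n
    using integrable_mult_indicator[OF A_M h] by simp
  have step: "a * prob (A n) \<le> expectation (\<lambda>\<omega>. indicator (A n) \<omega> * h \<omega>)" for n
  proof -
    interpret sigma_finite_subalgebra M "F n"
      by (rule sigma_finite_subalgebraI[OF sub_F])
    have ind: "(indicator (A n) :: 'a \<Rightarrow> real) \<in> borel_measurable (F n)"
      using AF by simp
    note cond = real_cond_exp_intg[OF int_Ah[of n] ind borel_measurable_integrable[OF h]]
    have "a * prob (A n) = expectation (\<lambda>\<omega>. a * indicator (A n) \<omega>)"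
      by simp
    also have "\<dots> \<le> expectation (\<lambda>\<omega>. indicator (A n) \<omega> * C n \<omega>)"
    proof (rule integral_mono)
      show "integrable M (\<lambda>\<omega>. a * indicator (A n) \<omega>)"
        by (intro integrable_mult_right integrable_real_indicator) (auto simp: less_top[symmetric])
      show "integrable M (\<lambda>\<omega>. indicator (A n) \<omega> * C n \<omega>)"
        unfolding C_def by (rule cond(1))
      have "a \<le> C n \<omega>" if "\<omega> \<in> A n" for \<omega>
        using that by (simp add: A_def)
      then show "a * indicator (A n) \<omega> \<le> indicator (A n) \<omega> * C n \<omega>" for \<omega>
        by (cases "\<omega> \<in> A n") simp_all
    qed
    also have "\<dots> = expectation (\<lambda>\<omega>. indicator (A n) \<omega> * h \<omega>)"
      unfolding C_def by (rule cond(2))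
    finally show ?thesis .
  qed
  have disj: "disjoint_family A"
    unfolding disjoint_family_on_def A_def by (auto) (metis linorder_neqE_nat)
  have partial: "(\<Sum>n<N. prob (A n)) \<le> expectation h / a" for N
  proof -
    have "a * (\<Sum>n<N. prob (A n)) \<le> (\<Sum>n<N. expectation (\<lambda>\<omega>. indicator (A n) \<omega> * h \<omega>))"
      unfolding sum_distrib_left by (intro sum_mono step)
    also have "\<dots> = expectation (\<lambda>\<omega>. \<Sum>n<N. indicator (A n) \<omega> * h \<omega>)"
      by (rule Bochner_Integration.integral_sum[symmetric]) (rule int_Ah)
    also have "\<dots> = expectation (\<lambda>\<omega>. indicator (\<Union>n<N. A n) \<omega> * h \<omega>)"
      using disj
      by (subst indicator_UN_disjoint)
         (auto simp: sum_distrib_right disjoint_family_on_def)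
    also have "\<dots> \<le> expectation h"
    proof (rule integral_mono)
      have "(\<Union>n<N. A n) \<in> sets M" by simp
      from integrable_mult_indicator[OF this h]
      show "integrable M (\<lambda>\<omega>. indicator (\<Union>n<N. A n) \<omega> * h \<omega>)" by simp
    qed (auto simp: indicator_def nonneg h)
    finally show ?thesis
      using a by (simp add: field_simps)
  qed
  have "{\<omega>\<in>space M. \<exists>n. C n \<omega> > a} = (\<Union>n. A n)"
  proof (intro equalityI subsetI)
    fix \<omega> assume "\<omega> \<in> {\<omega>\<in>space M. \<exists>n. C n \<omega> > a}"
    then show "\<omega> \<in> (\<Union>n. A n)"
      using exists_least_iff[of "\<lambda>n. C n \<omega> > a"] by (auto simp: A_def)
  qed (auto simp: A_def)
  moreover have "(\<lambda>n. prob (A n)) sums prob (\<Union>n. A n)"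
    using disj by (intro finite_measure_UNION) auto
  then have "prob (\<Union>n. A n) \<le> expectation h / a"
    by (intro LIMSEQ_le_const2[OF _ exI[of _ 0]]) (auto simp: sums_def partial)
  ultimately show ?thesis
    by (simp add: C_def)
qed

text \<open>Up to null sets this is the \<open>\<sigma>\<close>-algebra generated by all \<open>F n\<close>. Convergence theorems stated
  with it apply to target \<open>\<sigma>\<close>-algebras that agree with the generated one only modulo null sets.\<close>

definition approximable :: "'a set set" where
  "approximable = {A \<in> sets M. \<forall>\<epsilon>>0. \<exists>n. \<exists>B\<in>sets (F n). prob (sym_diff A B) < \<epsilon>}"

lemma sym_diff_M:
  assumes "A \<in> sets M" "B \<in> sets (F n)"
  shows "B \<in> sets M" "sym_diff A B \<in> sets M"
  using assms sub_F[of n] by (auto simp: subalgebra_def)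

lemma approximable_UN:
  fixes A :: "nat \<Rightarrow> 'a set"
  assumes A: "range A \<subseteq> approximable"
  shows "(\<Union>i. A i) \<in> approximable"
  unfolding approximable_def
proof (intro CollectI conjI allI impI)
  have A_M[measurable]: "A i \<in> sets M" for i
    using A by (auto simp: approximable_def)
  then show UN_M: "(\<Union>i. A i) \<in> sets M" by auto
  fix \<epsilon> :: real assume "0 < \<epsilon>"
  have "(\<lambda>N. prob (\<Union>i\<in>{..<N}. A i)) \<longlonglongrightarrow> prob (\<Union>N. \<Union>i\<in>{..<N}. A i)"
  proof (rule finite_Lim_measure_incseq)
    show "incseq (\<lambda>N. \<Union>i\<in>{..<N}. A i)"
      by (intro monoI UN_mono) auto
  qed auto
  also have "(\<Union>N. \<Union>i\<in>{..<N}. A i) = (\<Union>i. A i)"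
    by auto
  finally have "(\<lambda>N. prob (\<Union>i\<in>{..<N}. A i)) \<longlonglongrightarrow> prob (\<Union>i. A i)" .
  then have "\<forall>\<^sub>F N in sequentially. prob (\<Union>i. A i) - \<epsilon> / 2 < prob (\<Union>i\<in>{..<N}. A i)"
    using \<open>0 < \<epsilon>\<close> by (intro order_tendstoD) auto
  then obtain N where N: "prob (\<Union>i. A i) - \<epsilon> / 2 < prob (\<Union>i\<in>{..<N}. A i)"
    by (auto dest: eventually_happens)
  \<comment> \<open>Half of \<open>\<epsilon>\<close> pays for cutting the union off at \<open>N\<close>, the other half for the \<open>N\<close>
    approximations.\<close>
  define \<delta> where "\<delta> = \<epsilon> / (2 * real (Suc N))"
  have "0 < \<delta>" using \<open>0 < \<epsilon>\<close> by (simp add: \<delta>_def)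
  then have "\<exists>n B. B \<in> sets (F n) \<and> prob (sym_diff (A i) B) < \<delta>" for i
    using A unfolding approximable_def by blast
  then obtain m B where B: "\<And>i. B i \<in> sets (F (m i))" "\<And>i. prob (sym_diff (A i) (B i)) < \<delta>"
    by metis
  define n where "n = Max (insert 0 (m ` {..<N}))"
  have m_le: "m i \<le> n" if "i < N" for i
    unfolding n_def using that by (intro Max_ge) auto
  have B_F: "(\<Union>i\<in>{..<N}. B i) \<in> sets (F n)"
    using B(1) F_mono[OF m_le] by (intro sets.finite_UN) auto
  note [measurable] = sym_diff_M[OF A_M B(1)]
  have "prob (sym_diff (\<Union>i. A i) (\<Union>i\<in>{..<N}. B i))
      \<le> prob (((\<Union>i. A i) - (\<Union>i\<in>{..<N}. A i)) \<union> (\<Union>i\<in>{..<N}. sym_diff (A i) (B i)))"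
    by (rule finite_measure_mono) (auto intro!: sets.Un sets.Diff sets.finite_UN UN_M sym_diff_M(2)[OF A_M B(1)])
  also have "\<dots> \<le> prob ((\<Union>i. A i) - (\<Union>i\<in>{..<N}. A i)) + prob (\<Union>i\<in>{..<N}. sym_diff (A i) (B i))"
    by (rule measure_Un_le) (auto intro!: sets.Diff sets.finite_UN UN_M sym_diff_M(2)[OF A_M B(1)])
  also have "prob ((\<Union>i. A i) - (\<Union>i\<in>{..<N}. A i)) = prob (\<Union>i. A i) - prob (\<Union>i\<in>{..<N}. A i)"
    by (rule finite_measure_Diff) (auto intro: UN_M)
  also have "prob (\<Union>i\<in>{..<N}. sym_diff (A i) (B i)) \<le> (\<Sum>i<N. prob (sym_diff (A i) (B i)))"
    by (rule measure_UNION_le) (auto intro!: sym_diff_M(2)[OF A_M B(1)])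
  also have "(\<Sum>i<N. prob (sym_diff (A i) (B i))) \<le> (\<Sum>i<N. \<delta>)"
    by (intro sum_mono less_imp_le B(2))
  also have "(\<Sum>i<N. \<delta>) \<le> \<epsilon> / 2"
    using \<open>0 < \<epsilon>\<close> by (simp add: \<delta>_def field_simps)
  finally show "\<exists>n. \<exists>B\<in>sets (F n). prob (sym_diff (\<Union>i. A i) B) < \<epsilon>"
    using N B_F by (intro exI[of _ n] bexI[of _ "\<Union>i\<in>{..<N}. B i"]) auto
qed

lemma sigma_algebra_approximable: "sigma_algebra (space M) approximable"
proof (rule sigma_algebra_iff2[THEN iffD2], intro conjI ballI allI impI)
  show "approximable \<subseteq> Pow (space M)"
    using sets.sets_into_space by (auto simp: approximable_def)
  show "{} \<in> approximable"
    by (auto simp: approximable_def intro!: exI[of _ 0] bexI[of _ "{}"])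
  fix A assume "A \<in> approximable"
  then have A: "A \<in> sets M" "\<And>\<epsilon>. \<epsilon> > 0 \<Longrightarrow> \<exists>n. \<exists>B\<in>sets (F n). prob (sym_diff A B) < \<epsilon>"
    by (auto simp: approximable_def)
  show "space M - A \<in> approximable"
    unfolding approximable_def
  proof (intro CollectI conjI allI impI)
    show "space M - A \<in> sets M" using A(1) by auto
    fix \<epsilon> :: real assume "0 < \<epsilon>"
    then obtain n B where B: "B \<in> sets (F n)" "prob (sym_diff A B) < \<epsilon>"
      using A(2) by blast
    have "sym_diff (space M - A) (space (F n) - B) = sym_diff A B"
      using sets.sets_into_space[OF A(1)] sets.sets_into_space[OF B(1)] sub_F[of n]
      by (auto simp: subalgebra_def)
    then show "\<exists>n. \<exists>B\<in>sets (F n). prob (sym_diff (space M - A) B) < \<epsilon>"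
      using B(2) sets.compl_sets[OF B(1)] by (intro exI[of _ n] bexI[of _ "space (F n) - B"]) simp_all
  qed
qed (rule approximable_UN)

text \<open>Approximability of sets passes to indicators, then to sums and dominated limits of functions.\<close>

lemma L1_approximation_from_sets:
  fixes g :: "'a \<Rightarrow> real"
  assumes sub_G: "subalgebra M G"
    and approx: "sets G \<subseteq> approximable"
    and g: "integrable M g" "g \<in> borel_measurable G"
    and "0 < \<epsilon>"
  shows "\<exists>n h. integrable M h \<and> h \<in> borel_measurable (F n) \<and> expectation (\<lambda>\<omega>. \<bar>g \<omega> - h \<omega>\<bar>) < \<epsilon>"
proof -
  have up: "h \<in> borel_measurable (F n)" if "h \<in> borel_measurable (F m)" "m \<le> n" for h :: "'a \<Rightarrow> real" and m n
    using F_mono[OF that(2)] sub_F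
    by (intro measurable_from_subalg[OF _ that(1)]) (simp add: subalgebra_def)
  have "integrable (restr_to_subalg M G) g"
    using g sub_G by (simp add: integrable_in_subalg)
  then have "\<forall>\<epsilon>>0. \<exists>n h. integrable M h \<and> h \<in> borel_measurable (F n)
      \<and> expectation (\<lambda>\<omega>. \<bar>g \<omega> - h \<omega>\<bar>) < \<epsilon>"
  proof (induction rule: integrable_induct)
    case (base A c)
    have AG: "A \<in> sets G"
      using base sub_G by (simp add: sets_restr_to_subalg)
    show ?case
    proof (intro allI impI)
      fix \<epsilon> :: real assume "0 < \<epsilon>"
      then have "0 < \<epsilon> / (\<bar>c\<bar> + 1)"
        by (simp add: add_nonneg_pos)
      with approx AG obtain n B where B: "B \<in> sets (F n)"
        "prob (sym_diff A B) < \<epsilon> / (\<bar>c\<bar> + 1)" unfolding approximable_def by blast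
      have BM[measurable]: "B \<in> sets M" and AM[measurable]: "A \<in> sets M"
        using B(1) AG sub_F[of n] sub_G by (auto simp: subalgebra_def)
      have "\<bar>indicator A \<omega> *\<^sub>R c - indicator B \<omega> * c\<bar> = \<bar>c\<bar> * indicator (sym_diff A B) \<omega>" for \<omega>
        by (auto simp: indicator_def)
      then have "expectation (\<lambda>\<omega>. \<bar>indicator A \<omega> *\<^sub>R c - indicator B \<omega> * c\<bar>)
          = \<bar>c\<bar> * prob (sym_diff A B)"
        by simp
      also have "\<dots> \<le> (\<bar>c\<bar> + 1) * prob (sym_diff A B)"
        by (intro mult_right_mono) auto
      also have "\<dots> < \<epsilon>"
        using B(2) by (simp add: field_simps add_nonneg_pos pos_less_divide_eq)
      finally show "\<exists>n h. integrable M h \<and> h \<in> borel_measurable (F n)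
          \<and> expectation (\<lambda>\<omega>. \<bar>indicator A \<omega> *\<^sub>R c - h \<omega>\<bar>) < \<epsilon>"
        using B(1) BM
        by (intro exI[of _ n] exI[of _ "\<lambda>\<omega>. indicator B \<omega> * c"]) (auto simp: emeasure_eq_measure)
    qed
  next
    case (add g1 g2)
    have int: "integrable M g1" "integrable M g2"
      using add sub_G by (auto intro: integrable_from_subalg)
    show ?case
    proof (intro allI impI)
      fix \<epsilon> :: real assume "0 < \<epsilon>"
      then have half: "0 < \<epsilon> / 2" by simp
      obtain m h1 where h1: "integrable M h1" "h1 \<in> borel_measurable (F m)"
          "expectation (\<lambda>\<omega>. \<bar>g1 \<omega> - h1 \<omega>\<bar>) < \<epsilon> / 2"
        using add.IH(1) half by blast
      obtain n h2 where h2: "integrable M h2" "h2 \<in> borel_measurable (F n)"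
          "expectation (\<lambda>\<omega>. \<bar>g2 \<omega> - h2 \<omega>\<bar>) < \<epsilon> / 2"
        using add.IH(2) half by blast
      have "expectation (\<lambda>\<omega>. \<bar>g1 \<omega> + g2 \<omega> - (h1 \<omega> + h2 \<omega>)\<bar>)
          \<le> expectation (\<lambda>\<omega>. \<bar>g1 \<omega> - h1 \<omega>\<bar> + \<bar>g2 \<omega> - h2 \<omega>\<bar>)"
        using int h1(1) h2(1) by (intro integral_mono) auto
      also have "\<dots> < \<epsilon>"
        using int h1 h2 by simp
      finally show "\<exists>n h. integrable M h \<and> h \<in> borel_measurable (F n)
          \<and> expectation (\<lambda>\<omega>. \<bar>g1 \<omega> + g2 \<omega> - h \<omega>\<bar>) < \<epsilon>"
        using h1 h2
        by (intro exI[of _ "max m n"] exI[of _ "\<lambda>\<omega>. h1 \<omega> + h2 \<omega>"])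
           (auto intro!: borel_measurable_add up[OF h1(2) max.cobounded1] up[OF h2(2) max.cobounded2])
    qed
  next
    case (lim g s)
    have int: "integrable M g" "\<And>i. integrable M (s i)"
      using lim sub_G by (auto intro: integrable_from_subalg)
    have sp: "space (restr_to_subalg M G) = space M"
      by (rule space_restr_to_subalg)
    have "(\<lambda>i. expectation (\<lambda>\<omega>. \<bar>g \<omega> - s i \<omega>\<bar>)) \<longlonglongrightarrow> expectation (\<lambda>\<omega>. 0)"
    proof (rule integral_dominated_convergence[where w = "\<lambda>\<omega>. 3 * \<bar>g \<omega>\<bar>"])
      show "AE \<omega> in M. (\<lambda>i. \<bar>g \<omega> - s i \<omega>\<bar>) \<longlonglongrightarrow> 0"
      proof (rule AE_I2)
        fix \<omega> assume "\<omega> \<in> space M"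
        then have "(\<lambda>i. s i \<omega>) \<longlonglongrightarrow> g \<omega>"
          using lim.hyps(2) sp by auto
        from tendsto_diff[OF tendsto_const[of "g \<omega>"] this]
        show "(\<lambda>i. \<bar>g \<omega> - s i \<omega>\<bar>) \<longlonglongrightarrow> 0"
          by (simp add: tendsto_rabs_zero_iff)
      qed
      show "AE \<omega> in M. norm \<bar>g \<omega> - s i \<omega>\<bar> \<le> 3 * \<bar>g \<omega>\<bar>" for i
      proof (rule AE_I2)
        fix \<omega> assume "\<omega> \<in> space M"
        then have "norm (s i \<omega>) \<le> 2 * norm (g \<omega>)"
          using lim.hyps(3) sp by auto
        then show "norm \<bar>g \<omega> - s i \<omega>\<bar> \<le> 3 * \<bar>g \<omega>\<bar>" by auto
      qed
    qed (use int in auto)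
    then have conv: "(\<lambda>i. expectation (\<lambda>\<omega>. \<bar>g \<omega> - s i \<omega>\<bar>)) \<longlonglongrightarrow> 0"
      by simp
    show ?case
    proof (intro allI impI)
      fix \<epsilon> :: real assume "0 < \<epsilon>"
      then have half: "0 < \<epsilon> / 2" by simp
      obtain i where i: "expectation (\<lambda>\<omega>. \<bar>g \<omega> - s i \<omega>\<bar>) < \<epsilon> / 2"
        using order_tendstoD(2)[OF conv half] by (auto dest: eventually_happens)
      obtain n h where h: "integrable M h" "h \<in> borel_measurable (F n)"
          "expectation (\<lambda>\<omega>. \<bar>s i \<omega> - h \<omega>\<bar>) < \<epsilon> / 2"
        using lim.IH half by blast
      have "expectation (\<lambda>\<omega>. \<bar>g \<omega> - h \<omega>\<bar>) \<le> expectation (\<lambda>\<omega>. \<bar>g \<omega> - s i \<omega>\<bar> + \<bar>s i \<omega> - h \<omega>\<bar>)"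
        using int h(1) by (intro integral_mono) auto
      also have "\<dots> < \<epsilon>"
        using int i h by simp
      finally show "\<exists>n h. integrable M h \<and> h \<in> borel_measurable (F n)
          \<and> expectation (\<lambda>\<omega>. \<bar>g \<omega> - h \<omega>\<bar>) < \<epsilon>"
        using h by blast
    qed
  qed
  then show ?thesis
    using \<open>0 < \<epsilon>\<close> by blast
qed

text \<open>By the tower property \<open>f\<close> may be replaced by \<open>g = E(f | G)\<close>. Choose \<open>h\<close>, measurable with respect to
  some \<open>F m\<close> and close to \<open>g\<close> in \<open>L\<^sup>1\<close>. From time \<open>m\<close> on the conditional expectations leave \<open>h\<close>
  unchanged, so they move \<open>g\<close> by at most \<open>E(\<bar>g - h\<bar> | F n) + \<bar>g - h\<bar>\<close>. The first term is controlled
  uniformly in \<open>n\<close> by the maximal inequality, the second by Markov's inequality.\<close>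

theorem levy_upward:
  fixes f :: "'a \<Rightarrow> real"
  assumes sub_FG: "\<And>n. subalgebra G (F n)"
    and sub_G: "subalgebra M G"
    and approx: "sets G \<subseteq> approximable"
    and f: "integrable M f"
  shows "AE \<omega> in M. (\<lambda>n. real_cond_exp M (F n) f \<omega>) \<longlonglongrightarrow> real_cond_exp M G f \<omega>"
proof -
  interpret G: sigma_finite_subalgebra M G
    by (rule sigma_finite_subalgebraI[OF sub_G])
  define g where "g = real_cond_exp M G f"
  define C where "C n = real_cond_exp M (F n) g" for n
  have g: "integrable M g" "g \<in> borel_measurable G"
    using f by (auto simp: g_def G.real_cond_exp_int)
  have [measurable]: "g \<in> borel_measurable M" "C n \<in> borel_measurable M" for n
    using g by (auto simp: C_def)
  have tower: "AE \<omega> in M. C n \<omega> = real_cond_exp M (F n) f \<omega>" for n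
  proof -
    interpret sigma_finite_subalgebra M "F n"
      by (rule sigma_finite_subalgebraI[OF sub_F])
    show ?thesis
      unfolding C_def g_def by (rule real_cond_exp_nested_subalg[OF sub_G sub_FG f])
  qed
  define Bad where "Bad e = {\<omega>\<in>space M. \<forall>N. \<exists>n\<ge>N. \<bar>C n \<omega> - g \<omega>\<bar> > e}" for e
  have Bad_meas[measurable]: "Bad e \<in> sets M" for e
    unfolding Bad_def by measurable
  have Bad_le: "prob (Bad (2 * a)) \<le> \<epsilon> * 2 / a" if a: "0 < a" and eps: "0 < \<epsilon>" for a \<epsilon>
  proof -
    obtain m h where h: "integrable M h" "h \<in> borel_measurable (F m)"
      "expectation (\<lambda>\<omega>. \<bar>g \<omega> - h \<omega>\<bar>) < \<epsilon>"
      using L1_approximation_from_sets[OF sub_G approx g eps] by blast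
    have [measurable]: "h \<in> borel_measurable M"
      using h(1) by simp
    define r where "r \<omega> = \<bar>g \<omega> - h \<omega>\<bar>" for \<omega>
    have r: "integrable M r" "\<And>\<omega>. 0 \<le> r \<omega>"
      using g(1) h(1) by (auto simp: r_def[abs_def])
    have [measurable]: "r \<in> borel_measurable M"
      using r(1) by simp
    have Max: "prob {\<omega>\<in>space M. \<exists>n. real_cond_exp M (F n) r \<omega> > a} \<le> expectation r / a"
      by (rule doob_maximal_inequality[OF r a])
    have Markov: "prob {\<omega>\<in>space M. r \<omega> \<ge> a} \<le> expectation r / a"
      using r a by (intro integral_Markov_inequality_measure[where A = "{}"]) auto
    have dev: "AE \<omega> in M. \<bar>C n \<omega> - h \<omega>\<bar> \<le> real_cond_exp M (F n) r \<omega>" if "n \<ge> m" for n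
    proof -
      interpret sigma_finite_subalgebra M "F n"
        by (rule sigma_finite_subalgebraI[OF sub_F])
      have "h \<in> borel_measurable (F n)"
        using F_mono[OF that] sub_F
        by (intro measurable_from_subalg[OF _ h(2)]) (simp add: subalgebra_def)
      then have fix_h: "AE \<omega> in M. real_cond_exp M (F n) h \<omega> = h \<omega>"
        by (rule real_cond_exp_F_meas[OF h(1)])
      have "AE \<omega> in M. real_cond_exp M (F n) (\<lambda>\<omega>. g \<omega> - h \<omega>) \<omega> \<le> real_cond_exp M (F n) r \<omega>"
        using g(1) h(1) r(1) by (intro real_cond_exp_mono) (auto simp: r_def)
      moreover have "AE \<omega> in M. real_cond_exp M (F n) (\<lambda>\<omega>. h \<omega> - g \<omega>) \<omega> \<le> real_cond_exp M (F n) r \<omega>"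
        using g(1) h(1) r(1) by (intro real_cond_exp_mono) (auto simp: r_def)
      ultimately show ?thesis
        using fix_h real_cond_exp_diff[OF g(1) h(1)] real_cond_exp_diff[OF h(1) g(1)]
        by eventually_elim (auto simp: C_def)
    qed
    have "AE \<omega> in M. \<forall>n\<ge>m. \<bar>C n \<omega> - h \<omega>\<bar> \<le> real_cond_exp M (F n) r \<omega>"
      using dev by (simp add: AE_all_countable)
    then have "AE \<omega> in M. \<omega> \<in> Bad (2 * a) \<longrightarrow>
        \<omega> \<in> {\<omega>\<in>space M. \<exists>n. real_cond_exp M (F n) r \<omega> > a} \<union> {\<omega>\<in>space M. r \<omega> \<ge> a}"
    proof eventually_elim
      case (elim \<omega>)
      show ?case
      proof
        assume "\<omega> \<in> Bad (2 * a)"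
        then obtain n where n: "n \<ge> m" "\<bar>C n \<omega> - g \<omega>\<bar> > 2 * a" and sp: "\<omega> \<in> space M"
          unfolding Bad_def by blast
        have "\<bar>C n \<omega> - g \<omega>\<bar> \<le> \<bar>C n \<omega> - h \<omega>\<bar> + r \<omega>"
          by (simp add: r_def)
        moreover have "\<bar>C n \<omega> - h \<omega>\<bar> \<le> real_cond_exp M (F n) r \<omega>"
          using elim n(1) by blast
        ultimately have "real_cond_exp M (F n) r \<omega> > a \<or> r \<omega> \<ge> a"
          using n(2) by linarith
        then show "\<omega> \<in> {\<omega>\<in>space M. \<exists>n. real_cond_exp M (F n) r \<omega> > a} \<union> {\<omega>\<in>space M. r \<omega> \<ge> a}"
          using sp by blast
      qed
    qed
    then have "prob (Bad (2 * a)) \<le> prob ({\<omega>\<in>space M. \<exists>n. real_cond_exp M (F n) r \<omega> > a} \<union> {\<omega>\<in>space M. r \<omega> \<ge> a})"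
      by (intro finite_measure_mono_AE) (auto intro!: sets.Un)
    also have "\<dots> \<le> prob {\<omega>\<in>space M. \<exists>n. real_cond_exp M (F n) r \<omega> > a} + prob {\<omega>\<in>space M. r \<omega> \<ge> a}"
      by (rule measure_Un_le) measurable
    also have "\<dots> \<le> expectation r * 2 / a"
      by (rule order_trans[OF add_mono[OF Max Markov]]) (simp add: mult.commute)
    also have "\<dots> \<le> \<epsilon> * 2 / a"
      using h(3) a by (intro divide_right_mono) (auto simp: r_def[abs_def])
    finally show ?thesis .
  qed
  have "prob (Bad e) = 0" if "0 < e" for e
  proof -
    \<comment> \<open>With \<open>a = e / 2\<close> and \<open>\<epsilon> = \<delta> e / 4\<close> the bound \<open>2 \<epsilon> / a\<close> equals \<open>\<delta>\<close>.\<close>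
    have "prob (Bad e) \<le> 0 + \<delta>" if "0 < \<delta>" for \<delta>
      using Bad_le[of "e / 2" "\<delta> * e / 4"] that \<open>0 < e\<close> by simp
    then have "prob (Bad e) \<le> 0"
      by (rule field_le_epsilon)
    then show ?thesis
      by (simp add: measure_le_0_iff)
  qed
  then have "AE \<omega> in M. \<omega> \<notin> Bad (1 / Suc i)" for i
    using prob_eq_0[OF Bad_meas] by simp
  then have "AE \<omega> in M. \<forall>i. \<omega> \<notin> Bad (1 / Suc i)"
    by (simp add: AE_all_countable)
  moreover have "AE \<omega> in M. \<forall>n. C n \<omega> = real_cond_exp M (F n) f \<omega>"
    using tower by (simp add: AE_all_countable)
  ultimately show ?thesis
    using AE_space
  proof eventually_elim
    case (elim \<omega>)
    have "(\<lambda>n. C n \<omega>) \<longlonglongrightarrow> g \<omega>"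
    proof (rule LIMSEQ_I)
      fix e :: real assume "0 < e"
      then obtain i where i: "1 / Suc i < e"
        using reals_Archimedean[of e] by (auto simp: inverse_eq_divide)
      obtain N where "\<And>n. n \<ge> N \<Longrightarrow> \<not> \<bar>C n \<omega> - g \<omega>\<bar> > 1 / Suc i"
        using elim unfolding Bad_def by blast
      then show "\<exists>N. \<forall>n\<ge>N. norm (C n \<omega> - g \<omega>) < e"
        using i by (intro exI[of _ N]) force
    qed
    then show ?case
      using elim by (simp add: g_def)
  qed
qed

end

section \<open>Recurrence in stationary sequences\<close>

locale stationary_sequence = prob_space M for M :: "'w measure" +
  fixes S :: "'s measure" and Z :: "int \<Rightarrow> 'w \<Rightarrow> 's"
  assumes stationary: "stationary_process M S Z"
begin

abbreviation path_from :: "int \<Rightarrow> 'w \<Rightarrow> int \<Rightarrow> 's" where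
  "path_from s \<omega> \<equiv> (\<lambda>n. Z (n + s) \<omega>)"

abbreviation path_space :: "(int \<Rightarrow> 's) measure" where
  "path_space \<equiv> \<Pi>\<^sub>M n\<in>(UNIV :: int set). S"

lemma Z_measurable[measurable]: "Z n \<in> M \<rightarrow>\<^sub>M S"
  using stationary by (simp add: stationary_process_def)

lemma path_from_measurable: "path_from s \<in> M \<rightarrow>\<^sub>M path_space"
  by (rule measurable_PiM_single') (auto dest: measurable_space[OF Z_measurable])

lemma reindex_measurable: "(\<lambda>z n. z (f n)) \<in> path_space \<rightarrow>\<^sub>M path_space" for f :: "int \<Rightarrow> int"
  by (rule measurable_PiM_single') (auto simp: space_PiM PiE_def)

lemma pred_path_shift:
  assumes "Measurable.pred path_space Q"
  shows "Measurable.pred path_space (\<lambda>z. Q (\<lambda>n. z (n + s)))"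
  by (rule measurable_compose[OF reindex_measurable assms])

lemma pred_path_from:
  assumes "Measurable.pred path_space Q"
  shows "Measurable.pred M (\<lambda>\<omega>. Q (path_from s \<omega>))"
  by (rule measurable_compose[OF path_from_measurable assms])

text \<open>Invariance under one step of the shift, extended to all integer shifts.\<close>

lemma prob_path_from:
  assumes [measurable]: "Measurable.pred path_space Q"
  shows "prob {\<omega>\<in>space M. Q (path_from s \<omega>)} = prob {\<omega>\<in>space M. Q (\<lambda>n. Z n \<omega>)}"
proof -
  have path: "(\<lambda>\<omega> n. Z n \<omega>) \<in> M \<rightarrow>\<^sub>M path_space"
    using path_from_measurable[of 0] by simp
  have one: "prob {\<omega>\<in>space M. Q' (path_from 1 \<omega>)} = prob {\<omega>\<in>space M. Q' (\<lambda>n. Z n \<omega>)}"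
    if [measurable]: "Measurable.pred path_space Q'" for Q'
  proof -
    have sh: "shift \<in> path_space \<rightarrow>\<^sub>M path_space"
      unfolding shift_def[abs_def] by (rule reindex_measurable)
    have law: "path_law M S Z = distr M path_space (\<lambda>\<omega> n. Z n \<omega>)"
      by (simp add: path_law_def)
    have inv: "distr (path_law M S Z) path_space shift = path_law M S Z"
      using stationary by (simp add: stationary_process_def)
    define A where "A = {z\<in>space path_space. Q' z}"
    have A: "A \<in> sets path_space"
      unfolding A_def by measurable
    have in_space: "path_from s \<omega> \<in> space path_space" if "\<omega> \<in> space M" for s \<omega>
      by (rule measurable_space[OF path_from_measurable that])
    have "measure (path_law M S Z) A = prob ((\<lambda>\<omega> n. Z n \<omega>) -` A \<inter> space M)"
      unfolding law by (rule measure_distr[OF path A])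
    also have "(\<lambda>\<omega> n. Z n \<omega>) -` A \<inter> space M = {\<omega>\<in>space M. Q' (\<lambda>n. Z n \<omega>)}"
      using in_space[of _ 0] by (auto simp: A_def)
    finally have at_0: "measure (path_law M S Z) A = prob {\<omega>\<in>space M. Q' (\<lambda>n. Z n \<omega>)}" .
    have "distr (path_law M S Z) path_space shift = distr M path_space (path_from 1)"
      unfolding law by (subst distr_distr[OF sh path]) (simp add: shift_def comp_def)
    then have "measure (path_law M S Z) A = prob (path_from 1 -` A \<inter> space M)"
      using inv measure_distr[OF path_from_measurable A, of 1] by simp
    also have "path_from 1 -` A \<inter> space M = {\<omega>\<in>space M. Q' (path_from 1 \<omega>)}"
      using in_space[of _ 1] by (auto simp: A_def)
    finally show ?thesis
      using at_0 by simp
  qed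
  have step: "prob {\<omega>\<in>space M. Q (path_from (s + 1) \<omega>)} = prob {\<omega>\<in>space M. Q (path_from s \<omega>)}" for s
  proof -
    show ?thesis
      using one[OF pred_path_shift[OF assms, of s]] by (simp add: algebra_simps)
  qed
  show ?thesis
  proof (induction s rule: int_induct[where k = 0])
    case base
    then show ?case by simp
  next
    case (step1 i)
    then show ?case using step[of i] by simp
  next
    case (step2 i)
    then show ?case using step[of "i - 1"] by simp
  qed
qed

text \<open>The events ``\<open>Q\<close> holds from time \<open>c s\<close>, and never again from a later multiple of \<open>c\<close>'' are disjoint
  for different \<open>s\<close> and, by stationarity, equally likely. Hence they are null. The step \<open>c\<close> serves to
  treat the future (\<open>c = 1\<close>) and the past (\<open>c = -1\<close>) at once.\<close>

lemma poincare_recurrence: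
  fixes c :: int
  assumes Q[measurable]: "Measurable.pred path_space Q"
  shows "AE \<omega> in M. Q (path_from 0 \<omega>) \<longrightarrow> (\<exists>t>0. Q (path_from (c * int t) \<omega>))"
proof -
  note [measurable] = pred_path_shift[OF Q] pred_path_from[OF Q]
  define D where "D s = {\<omega>\<in>space M. Q (path_from (c * int s) \<omega>)
      \<and> (\<forall>t>0. \<not> Q (path_from (c * int (s + t)) \<omega>))}" for s
  have D_meas[measurable]: "D s \<in> sets M" for s
    unfolding D_def by measurable
  have same: "prob (D s) = prob (D 0)" for s
  proof -
    let ?W = "\<lambda>z. Q z \<and> (\<forall>t>0. \<not> Q (\<lambda>n. z (n + c * int t)))"
    have W: "Measurable.pred path_space ?W"
      by measurable
    have D_W: "D s = {\<omega>\<in>space M. ?W (path_from (c * int s) \<omega>)}" for s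
      unfolding D_def by (simp add: algebra_simps)
    have law: "prob (D s) = prob {\<omega>\<in>space M. ?W (\<lambda>n. Z n \<omega>)}" for s
      unfolding D_W by (rule prob_path_from[OF W])
    show ?thesis
      by (rule trans[OF law law[symmetric]])
  qed
  have "disjoint_family D"
    unfolding disjoint_family_on_def
  proof (intro ballI impI)
    have disj: "D m \<inter> D n = {}" if "m < n" for m n :: nat
    proof -
      obtain t where "n = m + t" "t > 0"
        using \<open>m < n\<close> less_imp_add_positive by blast
      then show ?thesis
        by (auto simp: D_def)
    qed
    fix m n :: nat assume "m \<noteq> n"
    then show "D m \<inter> D n = {}"
      using disj by (metis Int_commute linorder_neqE_nat)
  qed
  then have "(\<lambda>s. prob (D s)) sums prob (\<Union>s. D s)"
    by (intro finite_measure_UNION) auto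
  then have "(\<lambda>s. prob (D s)) \<longlonglongrightarrow> 0"
    by (rule summable_LIMSEQ_zero[OF sums_summable])
  moreover have "(\<lambda>s. prob (D s)) = (\<lambda>_. prob (D 0))"
    by (rule ext) (rule same)
  ultimately have "prob (D 0) = 0"
    by (simp only: LIMSEQ_const_iff)
  then have "AE \<omega> in M. \<omega> \<notin> D 0"
    using prob_eq_0[OF D_meas] by simp
  then show ?thesis
    using AE_space by eventually_elim (simp add: D_def)
qed

text \<open>The distribution of the path seen from the previous occurrence of \<open>Q\<close>. Let \<open>A t\<close> be the event
  that the previous occurrence is at \<open>-t\<close> and \<open>R\<close> holds there, and \<open>B t\<close> the event that the next
  occurrence is at \<open>t\<close> and \<open>R\<close> holds at 0. Shifting by \<open>t\<close> maps one to the other, and by recurrence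
  each of the two families exhausts, up to a null set, one of the two events that are compared.\<close>

lemma prob_at_backward_return:
  assumes Q[measurable]: "Measurable.pred path_space Q"
    and R[measurable]: "Measurable.pred path_space R"
  shows "prob {\<omega>\<in>space M. Q (path_from 0 \<omega>)
            \<and> R (path_from (- int (LEAST t. t > 0 \<and> Q (path_from (- int t) \<omega>))) \<omega>)}
       = prob {\<omega>\<in>space M. Q (path_from 0 \<omega>) \<and> R (path_from 0 \<omega>)}"
proof -
  note [measurable] = pred_path_shift[OF Q] pred_path_from[OF Q] pred_path_shift[OF R] pred_path_from[OF R]
  define A where "A t = {\<omega>\<in>space M. Q (path_from 0 \<omega>) \<and> Q (path_from (- int t) \<omega>)
      \<and> (\<forall>s. 0 < s \<and> s < t \<longrightarrow> \<not> Q (path_from (- int s) \<omega>)) \<and> R (path_from (- int t) \<omega>)}" for t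
  define B where "B t = {\<omega>\<in>space M. Q (path_from 0 \<omega>) \<and> Q (path_from (int t) \<omega>)
      \<and> (\<forall>s. 0 < s \<and> s < t \<longrightarrow> \<not> Q (path_from (int s) \<omega>)) \<and> R (path_from 0 \<omega>)}" for t
  define \<tau> where "\<tau> \<omega> = (LEAST t. t > 0 \<and> Q (path_from (- int t) \<omega>))" for \<omega>
  have [measurable]: "A t \<in> sets M" "B t \<in> sets M" for t
    unfolding A_def B_def by measurable
  have AB: "prob (A t) = prob (B t)" for t
  proof -
    let ?W = "\<lambda>z. Q z \<and> Q (\<lambda>n. z (n + - int t))
      \<and> (\<forall>s. 0 < s \<and> s < t \<longrightarrow> \<not> Q (\<lambda>n. z (n + - int s))) \<and> R (\<lambda>n. z (n + - int t))"
    have W: "Measurable.pred path_space ?W"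
      by measurable
    have reflect: "(\<forall>s. 0 < s \<and> s < t \<longrightarrow> \<not> Q (path_from (int t - int s) \<omega>))
        \<longleftrightarrow> (\<forall>s. 0 < s \<and> s < t \<longrightarrow> \<not> Q (path_from (int s) \<omega>))" for \<omega>
    proof -
      have "\<not> Q (path_from (int s) \<omega>)"
        if "\<forall>s. 0 < s \<and> s < t \<longrightarrow> \<not> Q (path_from (int t - int s) \<omega>)" "0 < s" "s < t" for s
        using that(1)[rule_format, of "t - s"] that(2,3) by (simp add: of_nat_diff)
      moreover have "\<not> Q (path_from (int t - int s) \<omega>)"
        if "\<forall>s. 0 < s \<and> s < t \<longrightarrow> \<not> Q (path_from (int s) \<omega>)" "0 < s" "s < t" for s
        using that(1)[rule_format, of "t - s"] that(2,3) by (simp add: of_nat_diff)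
      ultimately show ?thesis by blast
    qed
    have "A t = {\<omega>\<in>space M. ?W (\<lambda>n. Z n \<omega>)}"
      unfolding A_def by simp
    moreover have "B t = {\<omega>\<in>space M. ?W (path_from (int t) \<omega>)}"
      unfolding B_def reflect[symmetric] by (simp add: algebra_simps) blast
    ultimately show ?thesis
      using prob_path_from[OF W, of "int t"] by simp
  qed
  have disj: "disjoint_family (\<lambda>t. D (Suc t))"
    if first: "\<And>\<omega> m n. \<lbrakk>\<omega> \<in> D m; \<omega> \<in> D n; 0 < m; m < n\<rbrakk> \<Longrightarrow> False" for D :: "nat \<Rightarrow> 'w set"
    unfolding disjoint_family_on_def
  proof (intro ballI impI equals0I)
    fix m n :: nat and \<omega> assume "m \<noteq> n" "\<omega> \<in> D (Suc m) \<inter> D (Suc n)"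
    then show False
      using first[of \<omega> "Suc m" "Suc n"] first[of \<omega> "Suc n" "Suc m"]
      by (cases "m < n") auto
  qed
  have disjA: "disjoint_family (\<lambda>t. A (Suc t))"
    by (rule disj) (unfold A_def, blast)
  have disjB: "disjoint_family (\<lambda>t. B (Suc t))"
    by (rule disj) (unfold B_def, blast)
  have "(\<lambda>t. prob (A (Suc t))) sums prob (\<Union>t. A (Suc t))"
    by (intro finite_measure_UNION disjA) auto
  moreover have "(\<lambda>t. prob (B (Suc t))) sums prob (\<Union>t. B (Suc t))"
    by (intro finite_measure_UNION disjB) auto
  ultimately have eq: "prob (\<Union>t. A (Suc t)) = prob (\<Union>t. B (Suc t))"
    unfolding AB by (rule sums_unique2)
  have recur: "AE \<omega> in M. Q (path_from 0 \<omega>) \<longrightarrow>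
      (\<exists>t>0. Q (path_from (- int t) \<omega>)) \<and> (\<exists>t>0. Q (path_from (int t) \<omega>))"
    using poincare_recurrence[OF Q, of "-1"] poincare_recurrence[OF Q, of 1] by eventually_elim simp
  have \<tau>_meas[measurable]: "\<tau> \<in> M \<rightarrow>\<^sub>M count_space UNIV"
    unfolding \<tau>_def[abs_def] by measurable
  have "prob {\<omega>\<in>space M. Q (path_from 0 \<omega>) \<and> R (path_from (- int (\<tau> \<omega>)) \<omega>)} = prob (\<Union>t. A (Suc t))"
  proof (rule finite_measure_eq_AE)
    show "AE \<omega> in M. \<omega> \<in> {\<omega>\<in>space M. Q (path_from 0 \<omega>) \<and> R (path_from (- int (\<tau> \<omega>)) \<omega>)}
        \<longleftrightarrow> \<omega> \<in> (\<Union>t. A (Suc t))"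
      using recur AE_space
    proof eventually_elim
      case (elim \<omega>)
      show ?case
      proof
        assume "\<omega> \<in> {\<omega>\<in>space M. Q (path_from 0 \<omega>) \<and> R (path_from (- int (\<tau> \<omega>)) \<omega>)}"
        then have h: "Q (path_from 0 \<omega>)" "R (path_from (- int (\<tau> \<omega>)) \<omega>)" by auto
        with elim have ex: "\<exists>t. t > 0 \<and> Q (path_from (- int t) \<omega>)" by blast
        have "\<tau> \<omega> > 0 \<and> Q (path_from (- int (\<tau> \<omega>)) \<omega>)"
          unfolding \<tau>_def by (rule LeastI_ex[OF ex])
        moreover have "\<not> Q (path_from (- int s) \<omega>)" if "0 < s" "s < \<tau> \<omega>" for s
          using not_less_Least[of s "\<lambda>t. t > 0 \<and> Q (path_from (- int t) \<omega>)"] that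
          unfolding \<tau>_def by blast
        ultimately have "\<omega> \<in> A (\<tau> \<omega>)" and pos: "\<tau> \<omega> > 0"
          using h elim(2) unfolding A_def by blast+
        then show "\<omega> \<in> (\<Union>t. A (Suc t))"
          using gr0_implies_Suc[OF pos] by auto
      next
        assume "\<omega> \<in> (\<Union>t. A (Suc t))"
        then obtain t where t: "\<omega> \<in> A (Suc t)" by blast
        then have in_A: "\<omega> \<in> space M" "Q (path_from 0 \<omega>)" "R (path_from (- int (Suc t)) \<omega>)"
          unfolding A_def by blast+
        have tau: "\<tau> \<omega> = Suc t"
          unfolding \<tau>_def
        proof (rule Least_equality)
          show "Suc t \<le> s" if "s > 0 \<and> Q (path_from (- int s) \<omega>)" for s
            using t that not_less by (auto simp: A_def)
        qed (use t in \<open>auto simp: A_def\<close>)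
        have "R (path_from (- int (\<tau> \<omega>)) \<omega>)"
          unfolding tau by (rule in_A(3))
        then show "\<omega> \<in> {\<omega>\<in>space M. Q (path_from 0 \<omega>) \<and> R (path_from (- int (\<tau> \<omega>)) \<omega>)}"
          using in_A by blast
      qed
    qed
    show "{\<omega>\<in>space M. Q (path_from 0 \<omega>) \<and> R (path_from (- int (\<tau> \<omega>)) \<omega>)} \<in> sets M"
    proof -
      have "Measurable.pred M (\<lambda>\<omega>. R (path_from (- int (\<tau> \<omega>)) \<omega>))"
        by (rule measurable_compose_countable[OF _ \<tau>_meas]) measurable
      then show ?thesis by measurable
    qed
  qed auto
  moreover have "prob {\<omega>\<in>space M. Q (path_from 0 \<omega>) \<and> R (path_from 0 \<omega>)} = prob (\<Union>t. B (Suc t))"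
  proof (rule finite_measure_eq_AE)
    show "AE \<omega> in M. \<omega> \<in> {\<omega>\<in>space M. Q (path_from 0 \<omega>) \<and> R (path_from 0 \<omega>)}
        \<longleftrightarrow> \<omega> \<in> (\<Union>t. B (Suc t))"
      using recur AE_space
    proof eventually_elim
      case (elim \<omega>)
      show ?case
      proof
        assume "\<omega> \<in> {\<omega>\<in>space M. Q (path_from 0 \<omega>) \<and> R (path_from 0 \<omega>)}"
        then have h: "Q (path_from 0 \<omega>)" "R (path_from 0 \<omega>)" by auto
        with elim have ex: "\<exists>t. t > 0 \<and> Q (path_from (int t) \<omega>)" by blast
        define t where "t = (LEAST t. t > 0 \<and> Q (path_from (int t) \<omega>))"
        have "t > 0 \<and> Q (path_from (int t) \<omega>)"
          unfolding t_def by (rule LeastI_ex[OF ex])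
        moreover have "\<not> Q (path_from (int s) \<omega>)" if "0 < s" "s < t" for s
          using not_less_Least[of s "\<lambda>t. t > 0 \<and> Q (path_from (int t) \<omega>)"] that
          unfolding t_def by blast
        ultimately have "\<omega> \<in> B t" and pos: "t > 0"
          using h elim(2) unfolding B_def by blast+
        then show "\<omega> \<in> (\<Union>t. B (Suc t))"
          using gr0_implies_Suc[OF pos] by auto
      next
        assume "\<omega> \<in> (\<Union>t. B (Suc t))"
        then show "\<omega> \<in> {\<omega>\<in>space M. Q (path_from 0 \<omega>) \<and> R (path_from 0 \<omega>)}"
          unfolding B_def by blast
      qed
    qed
    show "{\<omega>\<in>space M. Q (path_from 0 \<omega>) \<and> R (path_from 0 \<omega>)} \<in> sets M"
      by measurable
  qed auto
  ultimately show ?thesis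
    using eq by (simp add: \<tau>_def)
qed

end

section \<open>Windows of a trajectory and their return times\<close>

lemma segment_shift: "segment (\<lambda>n. f (n + s)) i j = segment f (i + s) (j + s)"
proof -
  have "[i + s..j + s] = map (\<lambda>n. n + s) [i..j]"
    by (rule nth_equalityI) auto
  then show ?thesis
    by (simp add: segment_def)
qed

text \<open>What the construction observes on a stretch of length \<open>l\<close> into the past: the cells of
  \<open>X\<^sub>-\<^sub>l, \<dots>, X\<^sub>0\<close> and the labels \<open>Y\<^sub>-\<^sub>l, \<dots>, Y\<^sub>-\<^sub>1\<close>. The label at time 0 is to be predicted.\<close>

definition window :: "'x set set \<Rightarrow> nat \<Rightarrow> (int \<Rightarrow> 'x \<times> nat) \<Rightarrow> 'x set list \<times> nat list" where
  "window P l z = (map (quantizer P) (segment (\<lambda>n. fst (z n)) (- int l) 0),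
                   segment (\<lambda>n. snd (z n)) (- int l) (- 1))"

lemma window_eq_iff:
  "window P l z = window P l z' \<longleftrightarrow>
     (\<forall>n\<in>{- int l..0}. quantizer P (fst (z n)) = quantizer P (fst (z' n))) \<and>
     (\<forall>n\<in>{- int l..- 1}. snd (z n) = snd (z' n))"
  by (simp add: window_def segment_def)

abbreviation return_time :: "'x set set \<Rightarrow> (int \<Rightarrow> 'x \<times> nat) \<Rightarrow> nat \<Rightarrow> nat" where
  "return_time P z \<equiv> recurrence_time P (\<lambda>n. fst (z n)) (\<lambda>n. snd (z n))"

text \<open>The backward shift is written as addition of \<open>- int t\<close>, which makes it an instance of the integer
  shifts of the previous section.\<close>

lemma return_time_window:
  "return_time P z l = (LEAST t. t > 0 \<and> window P l (\<lambda>n. z (n + - int t)) = window P l z)"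
proof -
  have shift: "segment (\<lambda>n. f (z (n - int t))) i j = segment (\<lambda>n. f (z n)) (i - int t) (j - int t)"
    for f :: "'a \<times> nat \<Rightarrow> 'c" and t i j
    using segment_shift[of "\<lambda>n. f (z n)" "- int t" i j] by simp
  show ?thesis
    by (simp add: recurrence_time_def window_def shift)
qed

text \<open>The search for a return only inspects the path back to the place where the return is found. A path
  that agrees so far gives the same answers at all smaller \<open>t\<close>, and so has the same return time.\<close>

lemma return_time_determined:
  assumes ex: "\<exists>t>0. window P l (\<lambda>n. z (n + - int t)) = window P l z"
    and agree: "window P (return_time P z l + l) z' = window P (return_time P z l + l) z"
  shows "return_time P z' l = return_time P z l"
proof -
  define \<tau> where "\<tau> = return_time P z l"
  let ?R = "\<lambda>z t. t > 0 \<and> window P l (\<lambda>n. z (n + - int t)) = window P l z"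
  have same: "?R z' t \<longleftrightarrow> ?R z t" if "t \<le> \<tau>" for t
  proof -
    have "window P l (\<lambda>n. z' (n + - int t)) = window P l (\<lambda>n. z (n + - int t))"
      using agree that unfolding \<tau>_def[symmetric] window_eq_iff by auto
    moreover have "window P l z' = window P l z"
      using agree unfolding \<tau>_def[symmetric] window_eq_iff by auto
    ultimately show ?thesis by simp
  qed
  have \<tau>: "\<tau> = (LEAST t. ?R z t)"
    unfolding \<tau>_def by (rule return_time_window)
  have "?R z \<tau>"
    unfolding \<tau> by (rule LeastI_ex[OF ex])
  moreover have "\<not> ?R z t" if "t < \<tau>" for t
    using that unfolding \<tau> by (rule not_less_Least)
  ultimately have "(LEAST t. ?R z' t) = \<tau>"
    using same by (intro Least_equality) (meson less_imp_le not_less order_refl)+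
  then show ?thesis
    unfolding return_time_window[of P z'] by (simp add: \<tau>_def)
qed

locale nested_quantizers =
  fixes \<P> :: "nat \<Rightarrow> 'x set set"
  assumes partition: "1 \<le> k \<Longrightarrow> partition_on UNIV (\<P> k)"
    and nested: "1 \<le> k \<Longrightarrow> sigma_sets UNIV (\<P> k) \<subseteq> sigma_sets UNIV (\<P> (Suc k))"
begin

lemma quantizer_eq_iff:
  assumes "1 \<le> k"
  shows "quantizer (\<P> k) x = A \<longleftrightarrow> A \<in> \<P> k \<and> x \<in> A"
proof -
  have "\<exists>!A. A \<in> \<P> k \<and> x \<in> A"
    using partition_onD1[OF partition[OF assms]] disjointD[OF partition_onD2[OF partition[OF assms]]]
    by blast
  then show ?thesis
    unfolding quantizer_def by (metis (mono_tags, lifting) theI')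
qed

lemma quantizer_in: "1 \<le> k \<Longrightarrow> quantizer (\<P> k) x \<in> \<P> k"
  using quantizer_eq_iff by blast

text \<open>A set of the generated \<open>\<sigma>\<close>-algebra is a union of cells; this turns the inclusion of the
  \<open>\<sigma>\<close>-algebras into a refinement of the partitions.\<close>

lemma sigma_sets_not_split:
  assumes k: "1 \<le> k" and same: "quantizer (\<P> k) x = quantizer (\<P> k) x'"
    and "A \<in> sigma_sets UNIV (\<P> k)"
  shows "x \<in> A \<longleftrightarrow> x' \<in> A"
  using assms(3)
proof induction
  case (Basic A)
  then show ?case
    using same by (metis quantizer_eq_iff[OF k])
qed auto

lemma quantizer_coarsen:
  assumes "1 \<le> k" "k \<le> m" "quantizer (\<P> m) x = quantizer (\<P> m) x'"
  shows "quantizer (\<P> k) x = quantizer (\<P> k) x'"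
  using assms(2,3)
proof (induction rule: dec_induct)
  case (step m)
  have "1 \<le> m" using assms(1) step by simp
  define A where "A = quantizer (\<P> m) x"
  have A: "A \<in> \<P> m" "x \<in> A"
    using quantizer_eq_iff[OF \<open>1 \<le> m\<close>] by (auto simp: A_def)
  then have "A \<in> sigma_sets UNIV (\<P> (Suc m))"
    using nested[OF \<open>1 \<le> m\<close>] by blast
  then have "x' \<in> A"
    using sigma_sets_not_split[OF _ step.prems] A(2) by simp
  then have "quantizer (\<P> m) x' = A"
    using A(1) quantizer_eq_iff[OF \<open>1 \<le> m\<close>] by blast
  then show ?case
    using step.IH by (simp add: A_def)
qed

lemma window_coarsen:
  assumes "1 \<le> k" "k \<le> m" "l \<le> l'" "window (\<P> m) l' z = window (\<P> m) l' z'"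
  shows "window (\<P> k) l z = window (\<P> k) l z'"
  unfolding window_eq_iff
proof (intro conjI ballI)
  fix n assume "n \<in> {- int l..0}"
  then have "n \<in> {- int l'..0}"
    using assms(3) by simp
  then show "quantizer (\<P> k) (fst (z n)) = quantizer (\<P> k) (fst (z' n))"
    using assms(4) unfolding window_eq_iff by (intro quantizer_coarsen[OF assms(1,2)]) blast
next
  fix n assume "n \<in> {- int l..- 1}"
  then have "n \<in> {- int l'..- 1}"
    using assms(3) by simp
  then show "snd (z n) = snd (z' n)"
    using assms(4) unfolding window_eq_iff by blast
qed

abbreviation lam :: "(int \<Rightarrow> 'x \<times> nat) \<Rightarrow> nat \<Rightarrow> nat" where
  "lam z \<equiv> lambda_seq \<P> (\<lambda>n. fst (z n)) (\<lambda>n. snd (z n))"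

abbreviation tau :: "(int \<Rightarrow> 'x \<times> nat) \<Rightarrow> nat \<Rightarrow> nat" where
  "tau z \<equiv> tau_seq \<P> (\<lambda>n. fst (z n)) (\<lambda>n. snd (z n))"

text \<open>The paths on which every recurrence time of the construction is the time of an actual return. On
  other paths a recurrence time can be an arbitrary number, even 0.\<close>

definition recurrent :: "(int \<Rightarrow> 'x \<times> nat) \<Rightarrow> bool" where
  "recurrent z \<longleftrightarrow>
     (\<forall>k l. \<exists>t>0. window (\<P> (Suc k)) l (\<lambda>n. z (n + - int t)) = window (\<P> (Suc k)) l z)"

lemma tau_Suc: "tau z (Suc k) = return_time (\<P> (Suc k)) z (lam z k)"
  by (simp add: tau_seq_def)

lemma lam_Suc: "lam z (Suc k) = tau z (Suc k) + lam z k"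
  by (simp add: tau_Suc)

lemma tau_pos:
  assumes "recurrent z"
  shows "0 < tau z (Suc k)"
proof -
  have "\<exists>t. t > 0 \<and> window (\<P> (Suc k)) (lam z k) (\<lambda>n. z (n + - int t)) = window (\<P> (Suc k)) (lam z k) z"
    using assms unfolding recurrent_def by blast
  from LeastI_ex[OF this] show ?thesis
    unfolding tau_Suc return_time_window by blast
qed

lemma lam_ge: "recurrent z \<Longrightarrow> k < lam z k"
proof (induction k)
  case (Suc k)
  then have "k < lam z k" by blast
  then show ?case
    using tau_pos[OF Suc.prems, of k] unfolding lam_Suc by linarith
qed simp

text \<open>The stretch of the past on which the construction has relied by stage \<open>k\<close> reveals that stage's
  length: by induction, the observed window determines the earlier lengths, and then, by
  \<open>return_time_determined\<close>, the last return time.\<close>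

lemma lam_determined:
  assumes "recurrent z" "window (\<P> (Suc k)) (lam z k) z' = window (\<P> (Suc k)) (lam z k) z"
  shows "lam z' k = lam z k"
  using assms(2)
proof (induction k)
  case (Suc k)
  have "window (\<P> (Suc k)) (lam z k) z' = window (\<P> (Suc k)) (lam z k) z"
    by (rule window_coarsen[OF _ _ _ Suc.prems]) auto
  then have IH: "lam z' k = lam z k"
    by (rule Suc.IH)
  have "window (\<P> (Suc k)) (lam z (Suc k)) z' = window (\<P> (Suc k)) (lam z (Suc k)) z"
    by (rule window_coarsen[OF _ _ _ Suc.prems]) auto
  then have "return_time (\<P> (Suc k)) z' (lam z k) = return_time (\<P> (Suc k)) z (lam z k)"
    unfolding lam_Suc tau_Suc
    by (rule return_time_determined[rotated]) (rule assms(1)[unfolded recurrent_def, rule_format])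
  then show ?case
    unfolding lam_Suc tau_Suc IH by simp
qed simp

text \<open>The information from which \<open>\<tau>\<^sub>k\<^sub>+\<^sub>1\<close> is computed; therefore the window uses the partition of index
  \<open>k + 1\<close>.\<close>

definition pattern :: "nat \<Rightarrow> (int \<Rightarrow> 'x \<times> nat) \<Rightarrow> nat \<times> 'x set list \<times> nat list" where
  "pattern k z = (lam z k, window (\<P> (Suc k)) (lam z k) z)"

lemma pattern_eq_iff:
  assumes "recurrent z"
  shows "pattern k z' = pattern k z \<longleftrightarrow> window (\<P> (Suc k)) (lam z k) z' = window (\<P> (Suc k)) (lam z k) z"
proof
  assume h: "pattern k z' = pattern k z"
  then have "lam z' k = lam z k"
    unfolding pattern_def by blast
  with h show "window (\<P> (Suc k)) (lam z k) z' = window (\<P> (Suc k)) (lam z k) z"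
    by (simp add: pattern_def)
next
  assume w: "window (\<P> (Suc k)) (lam z k) z' = window (\<P> (Suc k)) (lam z k) z"
  then show "pattern k z' = pattern k z"
    using lam_determined[OF assms w] by (simp add: pattern_def)
qed

lemma pattern_determines_earlier:
  assumes "recurrent z" "pattern (Suc k) z' = pattern (Suc k) z"
  shows "pattern k z' = pattern k z"
proof -
  have "window (\<P> (Suc (Suc k))) (lam z (Suc k)) z' = window (\<P> (Suc (Suc k))) (lam z (Suc k)) z"
    using assms by (simp add: pattern_eq_iff)
  then have "window (\<P> (Suc k)) (lam z k) z' = window (\<P> (Suc k)) (lam z k) z"
    by (rule window_coarsen[rotated 3]) auto
  then show ?thesis
    using assms(1) by (simp add: pattern_eq_iff)
qed

text \<open>The matched label sits within the last \<open>\<lambda>\<^sub>k\<^sub>+\<^sub>1 = \<tau>\<^sub>k\<^sub>+\<^sub>1 + \<lambda>\<^sub>k\<close> time steps, hence is part of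
  the next pattern. This makes the deviations of the labels from their predictions martingale
  differences.\<close>

lemma pattern_determines_label:
  assumes "recurrent z" "pattern (Suc k) z' = pattern (Suc k) z"
  shows "snd (z' (- int (tau z' (Suc k)))) = snd (z (- int (tau z (Suc k))))"
proof -
  have "lam z' k = lam z k"
    using pattern_determines_earlier[OF assms] by (simp add: pattern_def)
  moreover have "lam z' (Suc k) = lam z (Suc k)"
    using assms(2) unfolding pattern_def by blast
  ultimately have same: "tau z' (Suc k) = tau z (Suc k)"
    unfolding lam_Suc by simp
  have "- int (tau z (Suc k)) \<in> {- int (lam z (Suc k))..- 1}"
    using tau_pos[OF assms(1), of k] unfolding lam_Suc by simp
  moreover have "window (\<P> (Suc (Suc k))) (lam z (Suc k)) z' = window (\<P> (Suc (Suc k))) (lam z (Suc k)) z"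
    using assms by (simp add: pattern_eq_iff)
  ultimately show ?thesis
    unfolding same window_eq_iff by blast
qed

text \<open>Since \<open>\<lambda>\<^sub>m > m\<close>, each fixed coordinate of the past, quantized at any fixed level, is eventually part of
  the pattern.\<close>

lemma pattern_determines_cell:
  assumes "recurrent z" "pattern m z' = pattern m z" "1 \<le> k" "k \<le> m" "n \<le> 0" "- n \<le> int m"
  shows "quantizer (\<P> k) (fst (z' n)) = quantizer (\<P> k) (fst (z n))"
    and "n < 0 \<Longrightarrow> snd (z' n) = snd (z n)"
proof -
  have "window (\<P> (Suc m)) (lam z m) z' = window (\<P> (Suc m)) (lam z m) z"
    using assms by (simp add: pattern_eq_iff)
  then have "window (\<P> k) (lam z m) z' = window (\<P> k) (lam z m) z"
    using assms by (intro window_coarsen[of k "Suc m"]) auto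
  then show "quantizer (\<P> k) (fst (z' n)) = quantizer (\<P> k) (fst (z n))"
    and "n < 0 \<Longrightarrow> snd (z' n) = snd (z n)"
    using lam_ge[OF assms(1), of m] assms(5,6) unfolding window_eq_iff by auto
qed

end

section \<open>Measurability of windows and return times\<close>

lemma pred_nat_eq:
  fixes f g :: "'w \<Rightarrow> nat"
  assumes f: "f \<in> N \<rightarrow>\<^sub>M count_space UNIV" and g: "g \<in> N \<rightarrow>\<^sub>M count_space UNIV"
  shows "Measurable.pred N (\<lambda>\<omega>. f \<omega> = g \<omega>)"
proof -
  have "Measurable.pred N (\<lambda>\<omega>. i = g \<omega>)" for i
    by (rule measurable_compose[OF g]) simp
  from measurable_compose_countable[OF this f] show ?thesis .
qed

text \<open>A random path, of which only what lies in the scope of windows needs to be observable. This covers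
  at once the process with its past as \<open>\<sigma>\<close>-algebra, the coordinate process on path space, and fixed
  paths.\<close>

definition past_measurable :: "'w measure \<Rightarrow> ('w \<Rightarrow> int \<Rightarrow> 'x::topological_space \<times> nat) \<Rightarrow> bool" where
  "past_measurable N W \<longleftrightarrow>
     (\<forall>n\<le>0. (\<lambda>\<omega>. fst (W \<omega> n)) \<in> N \<rightarrow>\<^sub>M borel) \<and>
     (\<forall>n<0. (\<lambda>\<omega>. snd (W \<omega> n)) \<in> N \<rightarrow>\<^sub>M count_space UNIV)"

lemma past_measurable_const: "past_measurable N (\<lambda>_. z)"
  by (simp add: past_measurable_def)

lemma past_measurable_back: "past_measurable N W \<Longrightarrow> past_measurable N (\<lambda>\<omega> n. W \<omega> (n + - int t))"
  by (simp add: past_measurable_def)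

locale borel_quantizers = nested_quantizers \<P> for \<P> :: "nat \<Rightarrow> 'x::topological_space set set" +
  assumes finite_cells: "1 \<le> k \<Longrightarrow> finite (\<P> k)"
    and generate: "sigma_sets UNIV (\<Union>k\<in>{1..}. sigma_sets UNIV (\<P> k)) = sets borel"
begin

lemma cell_borel:
  assumes "1 \<le> k" "A \<in> \<P> k"
  shows "A \<in> sets borel"
proof -
  have "A \<in> (\<Union>k\<in>{1..}. sigma_sets UNIV (\<P> k))"
    using assms by auto
  then show ?thesis
    unfolding generate[symmetric] by (rule sigma_sets.Basic)
qed

lemma pred_same_cell:
  assumes "1 \<le> k" and f: "f \<in> N \<rightarrow>\<^sub>M borel" and g: "g \<in> N \<rightarrow>\<^sub>M borel"
  shows "Measurable.pred N (\<lambda>\<omega>. quantizer (\<P> k) (f \<omega>) = quantizer (\<P> k) (g \<omega>))"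
proof -
  have mem: "Measurable.pred N (\<lambda>\<omega>. h \<omega> \<in> A)" if "h \<in> N \<rightarrow>\<^sub>M borel" "A \<in> \<P> k" for h A
    using measurable_sets[OF that(1) cell_borel[OF assms(1) that(2)]]
    by (simp add: pred_def vimage_def Int_def conj_commute)
  have "Measurable.pred N (\<lambda>\<omega>. \<exists>A\<in>\<P> k. f \<omega> \<in> A \<and> g \<omega> \<in> A)"
    by (intro pred_intros_finite pred_intros_logic mem f g finite_cells assms(1))
  moreover have "(\<exists>A\<in>\<P> k. f \<omega> \<in> A \<and> g \<omega> \<in> A) \<longleftrightarrow> quantizer (\<P> k) (f \<omega>) = quantizer (\<P> k) (g \<omega>)" for \<omega>
    using quantizer_eq_iff[OF assms(1)] by metis
  ultimately show ?thesis
    by simp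
qed

lemma pred_same_window:
  assumes "1 \<le> k" and W: "past_measurable N W" and W': "past_measurable N W'"
  shows "Measurable.pred N (\<lambda>\<omega>. window (\<P> k) l (W \<omega>) = window (\<P> k) l (W' \<omega>))"
proof -
  have "Measurable.pred N (\<lambda>\<omega>. \<forall>n\<in>{- int l..0}. quantizer (\<P> k) (fst (W \<omega> n)) = quantizer (\<P> k) (fst (W' \<omega> n)))"
    using W W' by (intro pred_intros_finite pred_same_cell assms(1)) (auto simp: past_measurable_def)
  moreover have "Measurable.pred N (\<lambda>\<omega>. \<forall>n\<in>{- int l..- 1}. snd (W \<omega> n) = snd (W' \<omega> n))"
  proof (intro pred_intros_finite)
    fix n assume "n \<in> {- int l..- 1}"
    then have "(\<lambda>\<omega>. snd (W \<omega> n)) \<in> N \<rightarrow>\<^sub>M count_space UNIV" "(\<lambda>\<omega>. snd (W' \<omega> n)) \<in> N \<rightarrow>\<^sub>M count_space UNIV"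
      using W W' by (auto simp: past_measurable_def)
    then show "Measurable.pred N (\<lambda>\<omega>. snd (W \<omega> n) = snd (W' \<omega> n))"
      by (rule pred_nat_eq)
  qed auto
  ultimately show ?thesis
    unfolding window_eq_iff by measurable
qed

text \<open>A value that no path attains makes the predicate constantly false; every other value is
  represented by a fixed path.\<close>

lemma pred_window_eq:
  assumes "1 \<le> k" "past_measurable N W"
  shows "Measurable.pred N (\<lambda>\<omega>. window (\<P> k) l (W \<omega>) = b)"
proof (cases "\<exists>z. window (\<P> k) l z = b")
  case True
  then obtain z where "b = window (\<P> k) l z" by blast
  then show ?thesis
    using pred_same_window[OF assms past_measurable_const] by simp
qed auto

lemma pred_recurrent:
  assumes "past_measurable N W"
  shows "Measurable.pred N (\<lambda>\<omega>. recurrent (W \<omega>))"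
  unfolding recurrent_def
  by (intro pred_intros_countable pred_intros_logic pred_same_window past_measurable_back assms) auto

lemma return_time_measurable:
  assumes "1 \<le> k" "past_measurable N W"
  shows "(\<lambda>\<omega>. return_time (\<P> k) (W \<omega>) l) \<in> N \<rightarrow>\<^sub>M count_space UNIV"
  unfolding return_time_window
  by (intro measurable_Least pred_intros_logic pred_same_window past_measurable_back assms) auto

lemma lam_measurable:
  assumes "past_measurable N W"
  shows "(\<lambda>\<omega>. lam (W \<omega>) k) \<in> N \<rightarrow>\<^sub>M count_space UNIV"
proof (induction k)
  case (Suc k)
  have "(\<lambda>\<omega>. return_time (\<P> (Suc k)) (W \<omega>) (lam (W \<omega>) k)) \<in> N \<rightarrow>\<^sub>M count_space UNIV"
    by (rule measurable_compose_countable[OF return_time_measurable Suc]) (use assms in auto)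
  with Suc show ?case
    unfolding lambda_seq.simps by measurable
qed simp

lemma tau_measurable:
  assumes "past_measurable N W"
  shows "(\<lambda>\<omega>. tau (W \<omega>) (Suc k)) \<in> N \<rightarrow>\<^sub>M count_space UNIV"
  unfolding tau_Suc
  by (rule measurable_compose_countable[OF return_time_measurable lam_measurable]) (use assms in auto)

lemma countable_patterns: "countable (range (pattern k))"
proof (rule countable_subset)
  show "range (pattern k) \<subseteq> UNIV \<times> lists (\<P> (Suc k)) \<times> UNIV"
    by (auto simp: pattern_def window_def quantizer_in)
  show "countable ((UNIV :: nat set) \<times> lists (\<P> (Suc k)) \<times> (UNIV :: nat list set))"
    using finite_cells[of "Suc k"] by (intro countable_SIGMA countable_lists) (auto intro: countable_finite)
qed

lemma countable_windows: "countable (range (window (\<P> (Suc k)) l))"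
proof (rule countable_subset)
  show "range (window (\<P> (Suc k)) l) \<subseteq> lists (\<P> (Suc k)) \<times> UNIV"
    by (auto simp: window_def quantizer_in)
  show "countable (lists (\<P> (Suc k)) \<times> (UNIV :: nat list set))"
    using finite_cells[of "Suc k"] by (intro countable_SIGMA countable_lists) (auto intro: countable_finite)
qed

lemma borel_measurable_from_cells:
  assumes "\<And>k A. \<lbrakk>1 \<le> k; A \<in> \<P> k\<rbrakk> \<Longrightarrow> f -` A \<inter> space N \<in> sets N"
  shows "f \<in> N \<rightarrow>\<^sub>M borel"
proof (rule measurable_sigma_sets[OF generate[symmetric]])
  fix B assume "B \<in> (\<Union>k\<in>{1..}. sigma_sets UNIV (\<P> k))"
  then obtain k where k: "1 \<le> k" "B \<in> sigma_sets UNIV (\<P> k)" by auto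
  have "f \<in> N \<rightarrow>\<^sub>M sigma UNIV (\<P> k)"
    by (rule measurable_measure_of) (use assms k(1) in auto)
  from measurable_sets[OF this, of B] show "f -` B \<inter> space N \<in> sets N"
    using k(2) by simp
qed auto

end

section \<open>The filtration of observed patterns\<close>

text \<open>In the \<open>\<sigma>\<close>-algebra of a countable partition, identities between measures need to be checked on
  atoms only.\<close>

lemma (in prob_space) prob_eq_from_countable_fibres:
  assumes countable: "countable (\<Phi> ` space M)"
    and fibre: "\<And>c. {\<omega>\<in>space M. \<Phi> \<omega> = c} \<in> events"
    and D: "D \<in> events" "D' \<in> events"
    and eq: "\<And>c. prob ({\<omega>\<in>space M. \<Phi> \<omega> = c} \<inter> D) = prob ({\<omega>\<in>space M. \<Phi> \<omega> = c} \<inter> D')"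
  shows "prob ({\<omega>\<in>space M. \<Phi> \<omega> \<in> S} \<inter> D) = prob ({\<omega>\<in>space M. \<Phi> \<omega> \<in> S} \<inter> D')"
proof -
  define I where "I = S \<inter> \<Phi> ` space M"
  have sum: "emeasure M ({\<omega>\<in>space M. \<Phi> \<omega> \<in> S} \<inter> E)
      = (\<integral>\<^sup>+c. emeasure M ({\<omega>\<in>space M. \<Phi> \<omega> = c} \<inter> E) \<partial>count_space I)" if "E \<in> events" for E
  proof -
    have "{\<omega>\<in>space M. \<Phi> \<omega> \<in> S} \<inter> E = (\<Union>c\<in>I. {\<omega>\<in>space M. \<Phi> \<omega> = c} \<inter> E)"
      by (auto simp: I_def)
    moreover have "emeasure M (\<Union>c\<in>I. {\<omega>\<in>space M. \<Phi> \<omega> = c} \<inter> E)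
        = (\<integral>\<^sup>+c. emeasure M ({\<omega>\<in>space M. \<Phi> \<omega> = c} \<inter> E) \<partial>count_space I)"
      using fibre that countable
      by (intro emeasure_UN_countable) (auto simp: I_def disjoint_family_on_def)
    ultimately show ?thesis by simp
  qed
  have "emeasure M ({\<omega>\<in>space M. \<Phi> \<omega> \<in> S} \<inter> D) = emeasure M ({\<omega>\<in>space M. \<Phi> \<omega> \<in> S} \<inter> D')"
    unfolding sum[OF D(1)] sum[OF D(2)] by (simp add: emeasure_eq_measure eq)
  then show ?thesis
    by (simp add: measure_def)
qed

locale quantized_process =
  borel_quantizers \<P> + stationary_sequence M obs_space "\<lambda>n \<omega>. (X n \<omega>, Y n \<omega>)"
  for \<P> :: "nat \<Rightarrow> 'x::topological_space set set" and M :: "'w measure"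
    and X :: "int \<Rightarrow> 'w \<Rightarrow> 'x" and Y :: "int \<Rightarrow> 'w \<Rightarrow> nat"
begin

abbreviation past :: "'w measure" where
  "past \<equiv> past_algebra M X Y"

abbreviation traj :: "'w \<Rightarrow> int \<Rightarrow> 'x \<times> nat" where
  "traj \<omega> \<equiv> (\<lambda>n. (X n \<omega>, Y n \<omega>))"

abbreviation label :: "'w \<Rightarrow> real" where
  "label \<equiv> indicator {\<omega>\<in>space M. Y 0 \<omega> = 1}"

lemma X_measurable: "X n \<in> M \<rightarrow>\<^sub>M borel"
  using measurable_compose[OF Z_measurable measurable_fst, of n] by simp

lemma Y_measurable: "Y n \<in> M \<rightarrow>\<^sub>M count_space {0, 1}"
  using measurable_compose[OF Z_measurable measurable_snd, of n] by simp

lemma count_space_UNIV_from_01: "f \<in> N \<rightarrow>\<^sub>M count_space {0, 1} \<Longrightarrow> f \<in> N \<rightarrow>\<^sub>M count_space (UNIV :: nat set)"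
  by (rule measurable_compose[of f N "count_space {0, 1}" "\<lambda>x. x"]) auto

lemma Y_measurable_UNIV[measurable]: "Y n \<in> M \<rightarrow>\<^sub>M count_space UNIV"
  by (rule count_space_UNIV_from_01[OF Y_measurable])

lemma Y_cases: "\<omega> \<in> space M \<Longrightarrow> Y n \<omega> = 0 \<or> Y n \<omega> = 1"
  using measurable_space[OF Y_measurable, of \<omega> n] by simp

lemma space_past[simp]: "space past = space M"
  by (simp add: past_algebra_def)

lemma past_maps: "(\<lambda>\<omega>. (X 0 \<omega>, \<lambda>n\<in>{..<0}. (X n \<omega>, Y n \<omega>)))
    \<in> M \<rightarrow>\<^sub>M borel \<Otimes>\<^sub>M (\<Pi>\<^sub>M n\<in>{..<0}. obs_space)"
  by (intro measurable_Pair X_measurable measurable_restrict Z_measurable)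

lemma past_subset:
  assumes "space N = space M"
    and X: "\<And>n. n \<le> 0 \<Longrightarrow> X n \<in> N \<rightarrow>\<^sub>M borel"
    and Y: "\<And>n. n < 0 \<Longrightarrow> Y n \<in> N \<rightarrow>\<^sub>M count_space {0, 1}"
  shows "sets past \<subseteq> sets N"
proof -
  let ?f = "\<lambda>\<omega>. (X 0 \<omega>, \<lambda>n\<in>{..<0}. (X n \<omega>, Y n \<omega>))"
  have "?f \<in> N \<rightarrow>\<^sub>M borel \<Otimes>\<^sub>M (\<Pi>\<^sub>M n\<in>{..<0}. obs_space)"
    by (intro measurable_Pair measurable_restrict X Y) auto
  note f = measurable_sets[OF this]
  have maps: "?f \<in> space M \<rightarrow> space (borel \<Otimes>\<^sub>M (\<Pi>\<^sub>M n\<in>{..<0}. obs_space))"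
    using measurable_space[OF past_maps] by (rule funcsetI)
  show ?thesis
  proof
    fix A assume "A \<in> sets past"
    then obtain B where "A = ?f -` B \<inter> space M" "B \<in> sets (borel \<Otimes>\<^sub>M (\<Pi>\<^sub>M n\<in>{..<0}. obs_space))"
      unfolding past_algebra_def sets_vimage_algebra2[OF maps] by blast
    then show "A \<in> sets N"
      using f[of B] assms(1) by simp
  qed
qed

lemma subalgebra_past: "subalgebra M past"
  unfolding subalgebra_def using past_subset[of M] X_measurable Y_measurable by simp

lemma X_past: "n \<le> 0 \<Longrightarrow> X n \<in> past \<rightarrow>\<^sub>M borel"
  and Y_past: "n < 0 \<Longrightarrow> Y n \<in> past \<rightarrow>\<^sub>M count_space {0, 1}"
proof -
  have f: "(\<lambda>\<omega>. (X 0 \<omega>, \<lambda>n\<in>{..<0}. (X n \<omega>, Y n \<omega>)))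
    \<in> past \<rightarrow>\<^sub>M borel \<Otimes>\<^sub>M (\<Pi>\<^sub>M n\<in>{..<0}. obs_space)"
    unfolding past_algebra_def
    by (rule measurable_vimage_algebra1) (use measurable_space[OF past_maps] in blast)
  have Z: "(\<lambda>\<omega>. (X n \<omega>, Y n \<omega>)) \<in> past \<rightarrow>\<^sub>M obs_space" if "n < 0" for n
    using measurable_compose[OF measurable_compose[OF f measurable_snd] measurable_component_singleton[of n "{..<0}"]] that
    by simp
  show "X n \<in> past \<rightarrow>\<^sub>M borel" if "n \<le> 0" for n
  proof (cases "n = 0")
    case True
    then show ?thesis
      using measurable_compose[OF f measurable_fst] by simp
  next
    case False
    then show ?thesis
      using measurable_compose[OF Z[of n] measurable_fst] that by simp
  qed
  show "Y n \<in> past \<rightarrow>\<^sub>M count_space {0, 1}" if "n < 0" for n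
    using measurable_compose[OF Z[OF that] measurable_snd] by simp
qed

lemma past_measurable_path: "past_measurable past traj"
  unfolding past_measurable_def fst_conv snd_conv
  by (intro conjI allI impI X_past count_space_UNIV_from_01[OF Y_past])

text \<open>The exceptional null set is removed from all constructions below, because measurability with respect
  to the past and monotonicity of the filtration are needed everywhere, not almost everywhere.\<close>

definition recurrent_set :: "'w set" where
  "recurrent_set = {\<omega>\<in>space M. recurrent (traj \<omega>)}"

lemma recurrent_set_past: "recurrent_set \<in> sets past"
  using pred_recurrent[OF past_measurable_path] by (simp add: recurrent_set_def pred_def)

lemma recurrent_set_M[measurable]: "recurrent_set \<in> sets M"
  using recurrent_set_past subalgebra_past by (auto simp: subalgebra_def)

lemma recurrent_setD: "\<omega> \<in> recurrent_set \<Longrightarrow> \<omega> \<in> space M" "\<omega> \<in> recurrent_set \<Longrightarrow> recurrent (traj \<omega>)"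
  by (simp_all add: recurrent_set_def)

lemma past_measurable_id: "past_measurable path_space (\<lambda>z. z)"
proof -
  have Z: "(\<lambda>z. z n) \<in> path_space \<rightarrow>\<^sub>M obs_space" for n
    by (rule measurable_component_singleton) simp
  show ?thesis
    unfolding past_measurable_def
    by (intro conjI allI impI measurable_compose[OF Z measurable_fst]
          count_space_UNIV_from_01[OF measurable_compose[OF Z measurable_snd]])
qed

text \<open>Poincare recurrence applies to each prescribed window, and there are only countably many.\<close>

lemma AE_recurrent_set: "AE \<omega> in M. \<omega> \<in> recurrent_set"
proof -
  have "AE \<omega> in M. \<exists>t>0. window (\<P> (Suc k)) l (\<lambda>n. traj \<omega> (n + - int t)) = window (\<P> (Suc k)) l (traj \<omega>)" for k l
  proof -
    have "AE \<omega> in M. \<forall>b\<in>range (window (\<P> (Suc k)) l). window (\<P> (Suc k)) l (traj \<omega>) = b \<longrightarrow>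
        (\<exists>t>0. window (\<P> (Suc k)) l (\<lambda>n. traj \<omega> (n + - int t)) = b)"
    proof (rule AE_ball_countable')
      fix b
      have "Measurable.pred path_space (\<lambda>z. window (\<P> (Suc k)) l z = b)"
        by (rule pred_window_eq[OF _ past_measurable_id]) simp
      from poincare_recurrence[OF this, of "-1"]
      show "AE \<omega> in M. window (\<P> (Suc k)) l (traj \<omega>) = b \<longrightarrow>
          (\<exists>t>0. window (\<P> (Suc k)) l (\<lambda>n. traj \<omega> (n + - int t)) = b)"
        by simp
    qed (rule countable_windows)
    then show ?thesis
      by eventually_elim blast
  qed
  then have "AE \<omega> in M. recurrent (traj \<omega>)"
    unfolding recurrent_def by (simp only: AE_all_countable) blast
  then show ?thesis
    using AE_space by eventually_elim (simp add: recurrent_set_def)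
qed

text \<open>A separate value \<open>None\<close> outside the recurrent paths keeps each history a function of the next.\<close>

definition history :: "nat \<Rightarrow> 'w \<Rightarrow> (nat \<times> 'x set list \<times> nat list) option" where
  "history n \<omega> = (if \<omega> \<in> recurrent_set then Some (pattern n (traj \<omega>)) else None)"

definition F :: "nat \<Rightarrow> 'w measure" where
  "F n = vimage_algebra (space M) (history n) (count_space UNIV)"

lemma history_eq_iff:
  assumes "\<omega>' \<in> recurrent_set"
  shows "history n \<omega> = history n \<omega>' \<longleftrightarrow> \<omega> \<in> recurrent_set \<and>
    window (\<P> (Suc n)) (lam (traj \<omega>') n) (traj \<omega>) = window (\<P> (Suc n)) (lam (traj \<omega>') n) (traj \<omega>')"
  using assms pattern_eq_iff[OF recurrent_setD(2)[OF assms], of n "traj \<omega>"] by (auto simp: history_def)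

lemma space_F[simp]: "space (F n) = space M"
  by (simp add: F_def)

lemma sets_F: "sets (F n) = {{\<omega>\<in>space M. history n \<omega> \<in> S} | S. True}"
  unfolding F_def by (subst sets_vimage_algebra2) (auto simp: vimage_def Int_def conj_commute)

text \<open>\<open>F n\<close> consists of all unions of history classes; as there are countably many classes, such unions
  inherit measurability from the classes.\<close>

lemma sets_F_I:
  assumes "A \<subseteq> space M"
    and "\<And>\<omega> \<omega>'. \<lbrakk>\<omega> \<in> space M; \<omega>' \<in> A; history n \<omega> = history n \<omega>'\<rbrakk> \<Longrightarrow> \<omega> \<in> A"
  shows "A \<in> sets (F n)"
proof -
  have "A = {\<omega>\<in>space M. history n \<omega> \<in> history n ` A}"
    using assms by blast
  then show ?thesis
    unfolding sets_F by blast
qed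

lemma countable_histories: "countable (history n ` space M)"
proof (rule countable_subset)
  show "history n ` space M \<subseteq> insert None (Some ` range (pattern n))"
    by (auto simp: history_def)
  show "countable (insert None (Some ` range (pattern n)))"
    using countable_patterns[of n] by auto
qed

lemma history_fibre_past: "{\<omega>\<in>space M. history n \<omega> = c} \<in> sets past"
proof (cases "\<exists>\<omega>'\<in>recurrent_set. history n \<omega>' = c")
  case True
  then obtain \<omega>' where \<omega>': "\<omega>' \<in> recurrent_set" "c = history n \<omega>'" by blast
  have "{\<omega>\<in>space M. history n \<omega> = c} = recurrent_set \<inter>
     {\<omega>\<in>space past. window (\<P> (Suc n)) (lam (traj \<omega>') n) (traj \<omega>) = window (\<P> (Suc n)) (lam (traj \<omega>') n) (traj \<omega>')}"
    unfolding \<omega>'(2) history_eq_iff[OF \<omega>'(1)] by (auto dest: recurrent_setD)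
  also have "\<dots> \<in> sets past"
    using pred_window_eq[OF _ past_measurable_path, of "Suc n"]
    by (intro sets.Int recurrent_set_past) (simp add: pred_def)
  finally show ?thesis .
next
  case False
  then have "{\<omega>\<in>space M. history n \<omega> = c} = (if c = None then space past - recurrent_set else {})"
    by (auto simp: history_def)
  then show ?thesis
    using sets.compl_sets[OF recurrent_set_past] by simp
qed

lemma subalgebra_past_F: "subalgebra past (F n)"
proof -
  have "{\<omega>\<in>space M. history n \<omega> \<in> S} \<in> sets past" for S
  proof -
    have "{\<omega>\<in>space M. history n \<omega> \<in> S} = (\<Union>c\<in>S \<inter> history n ` space M. {\<omega>\<in>space M. history n \<omega> = c})"
      by auto
    also have "\<dots> \<in> sets past"
      by (intro sets.countable_UN'' history_fibre_past) (use countable_histories in auto)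
    finally show ?thesis .
  qed
  then show ?thesis
    unfolding subalgebra_def sets_F by auto
qed

lemma subalgebra_F: "subalgebra M (F n)"
  using subalgebra_past subalgebra_past_F[of n] by (auto simp: subalgebra_def)

lemma F_mono: "m \<le> n \<Longrightarrow> sets (F m) \<subseteq> sets (F n)"
proof (rule lift_Suc_mono_le[of "\<lambda>n. sets (F n)"])
  fix n
  show "sets (F n) \<subseteq> sets (F (Suc n))"
  proof
    fix A assume "A \<in> sets (F n)"
    then obtain S where A: "A = {\<omega>\<in>space M. history n \<omega> \<in> S}"
      unfolding sets_F by blast
    show "A \<in> sets (F (Suc n))"
    proof (rule sets_F_I)
      fix \<omega> \<omega>' assume \<omega>: "\<omega> \<in> space M" "\<omega>' \<in> A" and eq: "history (Suc n) \<omega> = history (Suc n) \<omega>'"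
      have "history n \<omega> = history n \<omega>'"
      proof (cases "\<omega>' \<in> recurrent_set")
        case True
        then show ?thesis
          using eq pattern_determines_earlier[OF recurrent_setD(2)[OF True], of n "traj \<omega>"]
          by (auto simp: history_def split: if_splits)
      next
        case False
        then show ?thesis
          using eq by (auto simp: history_def split: if_splits)
      qed
      then show "\<omega> \<in> A"
        using \<omega> unfolding A by simp
    qed (auto simp: A)
  qed
qed

sublocale filtration: prob_filtration M F
  by unfold_locales (rule subalgebra_F, rule F_mono)

text \<open>The default 0 off the recurrent set matters for measurability: there, \<open>\<tau>\<close> might be 0, and
  the label would be \<open>Y\<^sub>0\<close>, which the past does not determine. The index starts at 0 for \<open>\<tau>\<^sub>1\<close>.\<close>

definition matched_label :: "nat \<Rightarrow> 'w \<Rightarrow> real" where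
  "matched_label n \<omega> = (if \<omega> \<in> recurrent_set then real (Y (- int (tau (traj \<omega>) (Suc n))) \<omega>) else 0)"

lemma matched_label_F: "matched_label n \<in> borel_measurable (F (Suc n))"
proof (rule measurableI)
  fix B :: "real set"
  show "matched_label n -` B \<inter> space (F (Suc n)) \<in> sets (F (Suc n))"
  proof (rule sets_F_I)
    fix \<omega> \<omega>' assume \<omega>: "\<omega> \<in> space M" "\<omega>' \<in> matched_label n -` B \<inter> space (F (Suc n))"
      and eq: "history (Suc n) \<omega> = history (Suc n) \<omega>'"
    have "matched_label n \<omega> = matched_label n \<omega>'"
    proof (cases "\<omega>' \<in> recurrent_set")
      case True
      then have "\<omega> \<in> recurrent_set" "pattern (Suc n) (traj \<omega>) = pattern (Suc n) (traj \<omega>')"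
        using eq by (auto simp: history_def split: if_splits)
      with pattern_determines_label[OF recurrent_setD(2)[OF True] this(2)] True show ?thesis
        by (simp add: matched_label_def)
    next
      case False
      then have "\<omega> \<notin> recurrent_set"
        using eq by (auto simp: history_def split: if_splits)
      with False show ?thesis
        by (simp add: matched_label_def)
    qed
    then show "\<omega> \<in> matched_label n -` B \<inter> space (F (Suc n))"
      using \<omega> by simp
  qed auto
qed simp

lemma matched_label_measurable[measurable]: "matched_label n \<in> borel_measurable M"
  by (rule measurable_from_subalg[OF subalgebra_F matched_label_F])

lemma matched_label_cases:
  assumes "\<omega> \<in> space M"
  shows "matched_label n \<omega> = 0 \<or> matched_label n \<omega> = 1"
  using Y_cases[OF assms, of "- int (tau (traj \<omega>) (Suc n))"] by (auto simp: matched_label_def)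

text \<open>On the recurrent set, a history class is the event that the window of a fixed length \<open>L\<close> has a prescribed
  value. On this event \<open>\<tau>\<^sub>n\<^sub>+\<^sub>1\<close> is the time since its previous occurrence, so that
  \<open>prob_at_backward_return\<close> applies with \<open>R\<close> the event that the current label is 1.\<close>

lemma prob_matched_label_on_fibre:
  "prob ({\<omega>\<in>space M. history n \<omega> = c} \<inter> {\<omega>\<in>space M. matched_label n \<omega> = 1})
   = prob ({\<omega>\<in>space M. history n \<omega> = c} \<inter> {\<omega>\<in>space M. Y 0 \<omega> = 1})"
proof -
  have fibre_M[measurable]: "{\<omega>\<in>space M. history n \<omega> = c} \<in> sets M"
    using history_fibre_past subalgebra_past by (auto simp: subalgebra_def)
  have Y0[measurable]: "{\<omega>\<in>space M. Y 0 \<omega> = 1} \<in> sets M"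
    by measurable
  have U1[measurable]: "{\<omega>\<in>space M. matched_label n \<omega> = 1} \<in> sets M"
    by measurable
  show ?thesis
  proof (cases "\<exists>\<omega>'\<in>recurrent_set. history n \<omega>' = c")
    case False
    then have "AE \<omega> in M. history n \<omega> \<noteq> c"
      using AE_recurrent_set by (auto elim!: eventually_mono)
    then show ?thesis
      by (intro finite_measure_eq_AE) auto
  next
    case True
    then obtain \<omega>' where \<omega>': "\<omega>' \<in> recurrent_set" "c = history n \<omega>'" by blast
    define L where "L = lam (traj \<omega>') n"
    define Q where "Q z \<longleftrightarrow> window (\<P> (Suc n)) L z = window (\<P> (Suc n)) L (traj \<omega>')" for z
    define R :: "(int \<Rightarrow> 'x \<times> nat) \<Rightarrow> bool" where "R z \<longleftrightarrow> snd (z 0) = 1" for z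
    have Q: "Measurable.pred path_space Q"
      unfolding Q_def[abs_def] by (rule pred_window_eq[OF _ past_measurable_id]) simp
    have R: "Measurable.pred path_space R"
    proof -
      have "(\<lambda>z. z 0) \<in> path_space \<rightarrow>\<^sub>M obs_space"
        by (rule measurable_component_singleton) simp
      then have "(\<lambda>z. snd (z 0)) \<in> path_space \<rightarrow>\<^sub>M count_space {0, 1}"
        by (rule measurable_compose[OF _ measurable_snd])
      from measurable_compose[OF this, of "\<lambda>y. y = 1" "count_space UNIV"] show ?thesis
        unfolding R_def[abs_def] by simp
    qed
    have in_fibre: "history n \<omega> = c \<longleftrightarrow> Q (traj \<omega>)" if "\<omega> \<in> recurrent_set" for \<omega>
      using that history_eq_iff[OF \<omega>'(1), of n \<omega>] by (simp add: \<omega>'(2) Q_def L_def)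
    define T where "T \<omega> = (LEAST t. t > 0 \<and> Q (\<lambda>n. traj \<omega> (n + - int t)))" for \<omega>
    have T: "tau (traj \<omega>) (Suc n) = T \<omega>" if "\<omega> \<in> recurrent_set" "Q (traj \<omega>)" for \<omega>
    proof -
      have "lam (traj \<omega>) n = L"
        using lam_determined[OF recurrent_setD(2)[OF \<omega>'(1)]] that(2) unfolding Q_def L_def by blast
      then show ?thesis
        using that(2) unfolding tau_Suc return_time_window T_def Q_def by simp
    qed
    have "prob ({\<omega>\<in>space M. history n \<omega> = c} \<inter> {\<omega>\<in>space M. matched_label n \<omega> = 1})
        = prob {\<omega>\<in>space M. Q (traj \<omega>) \<and> R (\<lambda>n. traj \<omega> (n + - int (T \<omega>)))}"
    proof (rule finite_measure_eq_AE)
      show "AE \<omega> in M. \<omega> \<in> {\<omega>\<in>space M. history n \<omega> = c} \<inter> {\<omega>\<in>space M. matched_label n \<omega> = 1}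
        \<longleftrightarrow> \<omega> \<in> {\<omega>\<in>space M. Q (traj \<omega>) \<and> R (\<lambda>n. traj \<omega> (n + - int (T \<omega>)))}"
        using AE_recurrent_set
      proof eventually_elim
        case (elim \<omega>)
        show ?case
          using in_fibre[OF elim] T[OF elim] recurrent_setD(1)[OF elim] elim
          by (auto simp: matched_label_def R_def)
      qed
      have T_meas: "T \<in> M \<rightarrow>\<^sub>M count_space UNIV"
        unfolding T_def[abs_def]
        by (intro measurable_Least pred_intros_logic pred_path_from[OF Q]) auto
      have "Measurable.pred M (\<lambda>\<omega>. R (\<lambda>n. traj \<omega> (n + - int (T \<omega>))))"
        by (rule measurable_compose_countable[OF pred_path_from[OF R] T_meas])
      moreover have "Measurable.pred M (\<lambda>\<omega>. Q (traj \<omega>))"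
        using pred_path_from[OF Q, of 0] by simp
      ultimately show "{\<omega>\<in>space M. Q (traj \<omega>) \<and> R (\<lambda>n. traj \<omega> (n + - int (T \<omega>)))} \<in> sets M"
        by (intro sets.sets_Collect_conj) (simp_all add: pred_def)
    qed measurable
    also have "\<dots> = prob {\<omega>\<in>space M. Q (traj \<omega>) \<and> R (traj \<omega>)}"
      using prob_at_backward_return[OF Q R] unfolding T_def by simp
    also have "\<dots> = prob ({\<omega>\<in>space M. history n \<omega> = c} \<inter> {\<omega>\<in>space M. Y 0 \<omega> = 1})"
    proof (rule finite_measure_eq_AE)
      show "AE \<omega> in M. \<omega> \<in> {\<omega>\<in>space M. Q (traj \<omega>) \<and> R (traj \<omega>)}
        \<longleftrightarrow> \<omega> \<in> {\<omega>\<in>space M. history n \<omega> = c} \<inter> {\<omega>\<in>space M. Y 0 \<omega> = 1}"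
        using AE_recurrent_set
      proof eventually_elim
        case (elim \<omega>)
        show ?case
          using in_fibre[OF elim] recurrent_setD(1)[OF elim] by (auto simp: R_def)
      qed
      have "Measurable.pred M (\<lambda>\<omega>. Q (traj \<omega>))" "Measurable.pred M (\<lambda>\<omega>. R (traj \<omega>))"
        using pred_path_from[OF Q, of 0] pred_path_from[OF R, of 0] by simp_all
      then show "{\<omega>\<in>space M. Q (traj \<omega>) \<and> R (traj \<omega>)} \<in> sets M"
        by (intro sets.sets_Collect_conj) (simp_all add: pred_def)
    qed measurable
    finally show ?thesis .
  qed
qed

section \<open>Convergence of the estimates and of the error probabilities\<close>

lemma label_measurable[measurable]: "label \<in> borel_measurable M"
  by measurable

lemma integrable_label: "integrable M label"
  by (rule integrable_const_bound[of _ 1]) (auto simp: indicator_def)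

lemma integrable_matched_label: "integrable M (matched_label n)"
proof (rule integrable_const_bound[of _ 1])
  show "AE \<omega> in M. norm (matched_label n \<omega>) \<le> 1"
  proof (rule AE_I2)
    fix \<omega> assume "\<omega> \<in> space M"
    from matched_label_cases[OF this, of n] show "norm (matched_label n \<omega>) \<le> 1"
      by auto
  qed
qed simp

lemma cond_exp_matched_label:
  "AE \<omega> in M. real_cond_exp M (F n) (matched_label n) \<omega> = real_cond_exp M (F n) label \<omega>"
proof -
  interpret sigma_finite_subalgebra M "F n"
    by (rule sigma_finite_subalgebraI[OF subalgebra_F])
  show ?thesis
  proof (rule real_cond_exp_charact)
    fix A assume A: "A \<in> sets (F n)"
    then obtain S where S: "A = {\<omega>\<in>space M. history n \<omega> \<in> S}"
      unfolding sets_F by blast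
    have A_M[measurable]: "A \<in> sets M"
      using A subalgebra_F[of n] by (auto simp: subalgebra_def)
    have fibre: "{\<omega>\<in>space M. history n \<omega> = c} \<in> sets M" for c
      using history_fibre_past subalgebra_past by (auto simp: subalgebra_def)
    have D: "{\<omega>\<in>space M. matched_label n \<omega> = 1} \<in> sets M" "{\<omega>\<in>space M. Y 0 \<omega> = 1} \<in> sets M"
      by measurable
    have "(\<integral>\<omega>\<in>A. matched_label n \<omega> \<partial>M)
        = (\<integral>\<omega>. indicator (A \<inter> {\<omega>\<in>space M. matched_label n \<omega> = 1}) \<omega> \<partial>M)"
      unfolding set_lebesgue_integral_def
    proof (rule Bochner_Integration.integral_cong)
      fix \<omega> assume "\<omega> \<in> space M"
      then show "indicator A \<omega> *\<^sub>R matched_label n \<omega>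
          = indicator (A \<inter> {\<omega>\<in>space M. matched_label n \<omega> = 1}) \<omega>"
        using matched_label_cases[of \<omega> n] by (auto simp: indicator_def)
    qed simp
    also have "\<dots> = prob (A \<inter> {\<omega>\<in>space M. matched_label n \<omega> = 1})"
      by simp
    also have "\<dots> = prob (A \<inter> {\<omega>\<in>space M. Y 0 \<omega> = 1})"
      unfolding S
      by (rule prob_eq_from_countable_fibres[OF countable_histories fibre D prob_matched_label_on_fibre])
    also have "\<dots> = (\<integral>\<omega>\<in>A. label \<omega> \<partial>M)"
      unfolding set_lebesgue_integral_def by (simp add: indicator_inter_arith[symmetric])
    also have "\<dots> = (\<integral>\<omega>\<in>A. real_cond_exp M (F n) label \<omega> \<partial>M)"
      by (rule real_cond_exp_intA[OF integrable_label A])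
    finally show "(\<integral>\<omega>\<in>A. matched_label n \<omega> \<partial>M) = (\<integral>\<omega>\<in>A. real_cond_exp M (F n) label \<omega> \<partial>M)" .
  qed (rule integrable_matched_label real_cond_exp_int(1)[OF integrable_label] borel_measurable_cond_exp)+
qed

lemma cond_exp_label_bounds:
  assumes "subalgebra M G"
  shows "AE \<omega> in M. 0 \<le> real_cond_exp M G label \<omega> \<and> real_cond_exp M G label \<omega> \<le> 1"
proof -
  interpret sigma_finite_subalgebra M G
    by (rule sigma_finite_subalgebraI[OF assms])
  have "AE \<omega> in M. real_cond_exp M G label \<omega> \<ge> 0"
    by (rule real_cond_exp_ge_c[OF integrable_label]) simp
  moreover have "AE \<omega> in M. real_cond_exp M G label \<omega> \<le> 1"
    by (rule real_cond_exp_le_c[OF integrable_label]) (simp add: indicator_def)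
  ultimately show ?thesis
    by eventually_elim simp
qed

text \<open>The deviations are orthogonal: for \<open>m < n\<close> the deviation of index \<open>m\<close> is \<open>F n\<close>-measurable, and the one
  of index \<open>n\<close> has conditional expectation 0 given \<open>F n\<close>.\<close>

lemma mean_matched_label_minus_prediction:
  "AE \<omega> in M. (\<lambda>k. (\<Sum>n<k. matched_label n \<omega> - real_cond_exp M (F n) label \<omega>) / real k) \<longlonglongrightarrow> 0"
proof (rule orthogonal_strong_law)
  define d where "d n \<omega> = matched_label n \<omega> - real_cond_exp M (F n) label \<omega>" for n \<omega>
  have d_eq: "(\<lambda>\<omega>. matched_label n \<omega> - real_cond_exp M (F n) label \<omega>) = d n" for n
    by (simp add: d_def[abs_def])
  show d_M: "(\<lambda>\<omega>. matched_label n \<omega> - real_cond_exp M (F n) label \<omega>) \<in> borel_measurable M" for n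
    by measurable
  show bound: "AE \<omega> in M. \<bar>matched_label n \<omega> - real_cond_exp M (F n) label \<omega>\<bar> \<le> 1" for n
    using cond_exp_label_bounds[OF subalgebra_F[of n]] AE_space
  proof eventually_elim
    case (elim \<omega>)
    then show ?case
      using matched_label_cases[of \<omega> n] by auto
  qed
  have int_d: "integrable M (d n)" for n
    using bound[of n] d_M[of n] unfolding d_eq by (intro integrable_const_bound[of _ 1]) (auto simp: d_def)
  fix m n :: nat assume "m < n"
  interpret sigma_finite_subalgebra M "F n"
    by (rule sigma_finite_subalgebraI[OF subalgebra_F])
  have up: "f \<in> borel_measurable (F n)" if "f \<in> borel_measurable (F i)" "i \<le> n" for f :: "'w \<Rightarrow> real" and i
    using F_mono[OF that(2)] by (intro measurable_from_subalg[OF _ that(1)]) (simp add: subalgebra_def)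
  have d_F: "d m \<in> borel_measurable (F n)"
    unfolding d_def[abs_def] using \<open>m < n\<close>
    by (intro borel_measurable_diff up[OF matched_label_F] up[OF borel_measurable_cond_exp]) auto
  have int_prod: "integrable M (\<lambda>\<omega>. d m \<omega> * d n \<omega>)"
  proof (rule integrable_const_bound[of _ 1])
    show "AE \<omega> in M. norm (d m \<omega> * d n \<omega>) \<le> 1"
      using bound[of m] bound[of n] by eventually_elim (simp add: d_def abs_mult mult_le_one)
    show "(\<lambda>\<omega>. d m \<omega> * d n \<omega>) \<in> borel_measurable M"
      using int_d by (intro borel_measurable_times borel_measurable_integrable)
  qed
  have zero: "AE \<omega> in M. real_cond_exp M (F n) (d n) \<omega> = 0"
  proof -
    have int_p: "integrable M (real_cond_exp M (F n) label)"
      by (rule real_cond_exp_int(1)[OF integrable_label])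
    have "AE \<omega> in M. real_cond_exp M (F n) (real_cond_exp M (F n) label) \<omega> = real_cond_exp M (F n) label \<omega>"
      by (rule real_cond_exp_F_meas[OF int_p borel_measurable_cond_exp])
    with real_cond_exp_diff[OF integrable_matched_label[of n] int_p] cond_exp_matched_label[of n]
    show ?thesis
      unfolding d_def[abs_def] by eventually_elim simp
  qed
  have "expectation (\<lambda>\<omega>. d m \<omega> * d n \<omega>) = expectation (\<lambda>\<omega>. d m \<omega> * real_cond_exp M (F n) (d n) \<omega>)"
    by (rule real_cond_exp_intg(2)[OF int_prod d_F borel_measurable_integrable[OF int_d], symmetric])
  also have "\<dots> = expectation (\<lambda>\<omega>. 0)"
  proof (rule integral_cong_AE)
    show "(\<lambda>\<omega>. d m \<omega> * real_cond_exp M (F n) (d n) \<omega>) \<in> borel_measurable M"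
      using int_d by (intro borel_measurable_times borel_measurable_integrable) auto
    show "AE \<omega> in M. d m \<omega> * real_cond_exp M (F n) (d n) \<omega> = 0"
      using zero by eventually_elim simp
  qed simp
  finally show "expectation (\<lambda>\<omega>. (matched_label m \<omega> - real_cond_exp M (F m) label \<omega>) *
      (matched_label n \<omega> - real_cond_exp M (F n) label \<omega>)) = 0"
    by (simp add: d_def)
qed

lemma F_approximable_mod_null:
  assumes "A \<in> sets M" "A \<inter> recurrent_set \<in> sets (F n)"
  shows "A \<in> filtration.approximable"
  unfolding filtration.approximable_def
proof (intro CollectI conjI allI impI)
  fix \<epsilon> :: real assume "0 < \<epsilon>"
  have "prob (sym_diff A (A \<inter> recurrent_set)) = prob {}"
    by (rule finite_measure_eq_AE) (use AE_recurrent_set assms(1) in \<open>auto elim!: eventually_mono\<close>)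
  then show "\<exists>n. \<exists>B\<in>sets (F n). prob (sym_diff A B) < \<epsilon>"
    using assms(2) \<open>0 < \<epsilon>\<close> by (intro exI[of _ n] bexI[of _ "A \<inter> recurrent_set"]) auto
qed (rule assms)

text \<open>It suffices that each coordinate of the past is measurable with respect to the approximable
  sets, and for this that cells and labels are. On the recurrent set the latter already belong to a single \<open>F m\<close>.\<close>

lemma past_approximable: "sets past \<subseteq> filtration.approximable"
proof -
  define N where "N = sigma (space M) filtration.approximable"
  interpret A: sigma_algebra "space M" filtration.approximable
    by (rule filtration.sigma_algebra_approximable)
  have N: "space N = space M" "sets N = filtration.approximable"
    unfolding N_def by (simp_all add: A.space_closed)
  have "sets past \<subseteq> sets N"
  proof (rule past_subset[OF N(1)])
    fix n :: int assume n: "n \<le> 0"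
    show "X n \<in> N \<rightarrow>\<^sub>M borel"
    proof (rule borel_measurable_from_cells)
      fix k A assume k: "1 \<le> k" "A \<in> \<P> k"
      define m where "m = max k (nat (- n))"
      have m: "k \<le> m" "- n \<le> int m" by (auto simp: m_def)
      have "X n -` A \<inter> space M \<in> filtration.approximable"
      proof (rule F_approximable_mod_null)
        show "X n -` A \<inter> space M \<in> sets M"
          by (rule measurable_sets[OF X_measurable cell_borel[OF k]])
        show "X n -` A \<inter> space M \<inter> recurrent_set \<in> sets (F m)"
        proof (rule sets_F_I)
          fix \<omega> \<omega>' assume \<omega>: "\<omega> \<in> space M" "\<omega>' \<in> X n -` A \<inter> space M \<inter> recurrent_set"
            and eq: "history m \<omega> = history m \<omega>'"
          then have c: "\<omega> \<in> recurrent_set" "pattern m (traj \<omega>) = pattern m (traj \<omega>')"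
            by (auto simp: history_def split: if_splits)
          have "recurrent (traj \<omega>')" using \<omega>(2) recurrent_setD by blast
          from pattern_determines_cell(1)[OF this c(2) k(1) m(1) n m(2)]
          have "quantizer (\<P> k) (X n \<omega>) = quantizer (\<P> k) (X n \<omega>')" by simp
          moreover have "quantizer (\<P> k) (X n \<omega>') = A"
            using \<omega>(2) k(2) by (simp add: quantizer_eq_iff[OF k(1)])
          ultimately have "X n \<omega> \<in> A"
            using quantizer_eq_iff[OF k(1)] by metis
          then show "\<omega> \<in> X n -` A \<inter> space M \<inter> recurrent_set"
            using \<omega>(1) c(1) by simp
        qed auto
      qed
      then show "X n -` A \<inter> space N \<in> sets N"
        by (simp add: N)
    qed
  next
    fix n :: int assume n: "n < 0"
    define m where "m = max 1 (nat (- n))"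
    have m: "1 \<le> m" "- n \<le> int m" by (auto simp: m_def)
    have "Y n -` {y} \<inter> space M \<in> filtration.approximable" for y
    proof (rule F_approximable_mod_null)
      show "Y n -` {y} \<inter> space M \<in> sets M"
        by (rule measurable_sets[OF Y_measurable_UNIV]) simp
      show "Y n -` {y} \<inter> space M \<inter> recurrent_set \<in> sets (F m)"
      proof (rule sets_F_I)
        fix \<omega> \<omega>' assume \<omega>: "\<omega> \<in> space M" "\<omega>' \<in> Y n -` {y} \<inter> space M \<inter> recurrent_set"
          and eq: "history m \<omega> = history m \<omega>'"
        then have c: "\<omega> \<in> recurrent_set" "pattern m (traj \<omega>) = pattern m (traj \<omega>')"
          by (auto simp: history_def split: if_splits)
        have "recurrent (traj \<omega>')" using \<omega>(2) recurrent_setD by blast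
        from pattern_determines_cell(2)[OF this c(2) order_refl m(1) less_imp_le[OF n] m(2) n]
        have "Y n \<omega> = Y n \<omega>'" by simp
        then show "\<omega> \<in> Y n -` {y} \<inter> space M \<inter> recurrent_set"
          using \<omega> c(1) by simp
      qed auto
    qed
    moreover have "Y n \<in> space M \<rightarrow> {0, 1}"
      using Y_cases by auto
    ultimately show "Y n \<in> N \<rightarrow>\<^sub>M count_space {0, 1}"
      by (subst measurable_count_space_eq2) (auto simp: N)
  qed
  then show ?thesis
    by (simp add: N(2))
qed

lemma predictions_tendsto:
  "AE \<omega> in M. (\<lambda>n. real_cond_exp M (F n) label \<omega>) \<longlonglongrightarrow> real_cond_exp M past label \<omega>"
  by (rule filtration.levy_upward[OF subalgebra_past_F subalgebra_past past_approximable integrable_label])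

theorem mean_matched_label_tendsto:
  "AE \<omega> in M. (\<lambda>k. (\<Sum>n<k. matched_label n \<omega>) / real k) \<longlonglongrightarrow> real_cond_exp M past label \<omega>"
  using mean_matched_label_minus_prediction predictions_tendsto
proof eventually_elim
  case (elim \<omega>)
  from tendsto_add[OF elim(1) cesaro_mean_tendsto[OF elim(2)]] show ?case
    by (simp add: sum_subtractf add_divide_distrib[symmetric])
qed

lemma eta_est_eq_mean:
  assumes "\<omega> \<in> recurrent_set"
  shows "eta_est \<P> (\<lambda>n. X n \<omega>) (\<lambda>n. Y n \<omega>) k = (\<Sum>n<k. matched_label n \<omega>) / real k"
proof -
  have "(\<Sum>j=1..k. real (Y (- int (tau (traj \<omega>) j)) \<omega>)) = (\<Sum>n<k. matched_label n \<omega>)"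
    using assms by (simp add: matched_label_def sum.atLeast1_atMost_eq)
  then show ?thesis
    by (simp add: eta_est_def)
qed

lemma error_event:
  assumes "g \<in> M \<rightarrow>\<^sub>M count_space UNIV"
  shows "{\<omega>\<in>space M. g \<omega> \<noteq> Y 0 \<omega>} \<in> sets M"
  using pred_nat_eq[OF assms Y_measurable_UNIV] by (intro sets.sets_Collect_neg) (simp add: pred_def)

text \<open>For values in \<open>{0, 1}\<close> the error indicator is \<open>g + (1 - 2 g) Y\<^sub>0\<close>, in which the coefficients are known
  from the past.\<close>

lemma cond_error_prob:
  assumes g: "g \<in> past \<rightarrow>\<^sub>M count_space UNIV" and g01: "\<And>\<omega>. g \<omega> = 0 \<or> g \<omega> = (1::nat)"
  shows "AE \<omega> in M. prob_given M past (\<lambda>\<omega>. g \<omega> \<noteq> Y 0 \<omega>) \<omega> =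
    (if g \<omega> = 1 then 1 - real_cond_exp M past label \<omega> else real_cond_exp M past label \<omega>)"
proof -
  interpret P: sigma_finite_subalgebra M past
    by (rule sigma_finite_subalgebraI[OF subalgebra_past])
  have g_M[measurable]: "g \<in> M \<rightarrow>\<^sub>M count_space UNIV"
    by (rule measurable_from_subalg[OF subalgebra_past g])
  define a where "a \<omega> = real (g \<omega>)" for \<omega>
  define b where "b \<omega> = 1 - 2 * real (g \<omega>)" for \<omega>
  have ab: "a \<in> borel_measurable past" "b \<in> borel_measurable past"
    unfolding a_def[abs_def] b_def[abs_def] using g by measurable
  have ab_M[measurable]: "a \<in> borel_measurable M" "b \<in> borel_measurable M"
    using ab by (auto intro: measurable_from_subalg[OF subalgebra_past])
  have "\<bar>a \<omega>\<bar> \<le> 1" "\<bar>b \<omega> * label \<omega>\<bar> \<le> 1" for \<omega>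
    using g01[of \<omega>] by (auto simp: a_def b_def indicator_def)
  then have int: "integrable M a" "integrable M (\<lambda>\<omega>. b \<omega> * label \<omega>)"
    by (auto intro!: integrable_const_bound[of _ 1])
  have err: "indicator {\<omega>\<in>space M. g \<omega> \<noteq> Y 0 \<omega>} \<omega> = a \<omega> + b \<omega> * label \<omega>" if "\<omega> \<in> space M" for \<omega>
    using that Y_cases[OF that, of 0] g01[of \<omega>] by (auto simp: a_def b_def indicator_def)
  have "AE \<omega> in M. prob_given M past (\<lambda>\<omega>. g \<omega> \<noteq> Y 0 \<omega>) \<omega> = real_cond_exp M past (\<lambda>\<omega>. a \<omega> + b \<omega> * label \<omega>) \<omega>"
    unfolding prob_given_def
  proof (rule P.real_cond_exp_cong)
    show "AE \<omega> in M. indicator {\<omega>\<in>space M. g \<omega> \<noteq> Y 0 \<omega>} \<omega> = a \<omega> + b \<omega> * label \<omega>"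
      by (rule AE_I2) (rule err)
    show "(indicator {\<omega>\<in>space M. g \<omega> \<noteq> Y 0 \<omega>} :: 'w \<Rightarrow> real) \<in> borel_measurable M"
      by (rule borel_measurable_indicator[OF error_event[OF g_M]])
  qed measurable
  moreover have "AE \<omega> in M. real_cond_exp M past (\<lambda>\<omega>. a \<omega> + b \<omega> * label \<omega>) \<omega>
      = real_cond_exp M past a \<omega> + real_cond_exp M past (\<lambda>\<omega>. b \<omega> * label \<omega>) \<omega>"
    by (rule P.real_cond_exp_add[OF int])
  moreover have "AE \<omega> in M. real_cond_exp M past a \<omega> = a \<omega>"
    by (rule P.real_cond_exp_F_meas[OF int(1) ab(1)])
  moreover have "AE \<omega> in M. real_cond_exp M past (\<lambda>\<omega>. b \<omega> * label \<omega>) \<omega> = b \<omega> * real_cond_exp M past label \<omega>"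
    by (rule P.real_cond_exp_mult[OF ab(2) label_measurable int(2)])
  ultimately show ?thesis
  proof eventually_elim
    case (elim \<omega>)
    then show ?case
      using g01[of \<omega>] by (auto simp: a_def b_def)
  qed
qed

text \<open>A version of the estimated decision that is measurable with respect to the past everywhere; it agrees with
  \<open>g_est\<close> on the recurrent set.\<close>

definition mean_decision :: "nat \<Rightarrow> 'w \<Rightarrow> nat" where
  "mean_decision k \<omega> = (if (\<Sum>n<k. matched_label n \<omega>) / real k \<ge> 1 / 2 then 1 else 0)"

lemma matched_label_past[measurable]: "matched_label n \<in> borel_measurable past"
  by (rule measurable_from_subalg[OF subalgebra_past_F matched_label_F])

lemma mean_decision_past: "mean_decision k \<in> past \<rightarrow>\<^sub>M count_space UNIV"
  unfolding mean_decision_def[abs_def] by measurable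

lemma bayes_decision_past: "bayes_decision M X Y \<in> past \<rightarrow>\<^sub>M count_space UNIV"
  unfolding bayes_decision_def[abs_def] prob_given_def by measurable

lemma g_est_measurable[measurable]: "(\<lambda>\<omega>. g_est \<P> (\<lambda>n. X n \<omega>) (\<lambda>n. Y n \<omega>) k) \<in> M \<rightarrow>\<^sub>M count_space UNIV"
proof -
  have tau_M: "(\<lambda>\<omega>. tau (traj \<omega>) (Suc n)) \<in> M \<rightarrow>\<^sub>M count_space UNIV" for n
    by (rule measurable_from_subalg[OF subalgebra_past tau_measurable[OF past_measurable_path]])
  have "(\<lambda>\<omega>. Y (- int (tau (traj \<omega>) (Suc n))) \<omega>) \<in> M \<rightarrow>\<^sub>M count_space UNIV" for n
    by (rule measurable_compose_countable[OF Y_measurable_UNIV tau_M])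
  then have [measurable]: "(\<lambda>\<omega>. Y (- int (tau_seq \<P> (\<lambda>n. X n \<omega>) (\<lambda>n. Y n \<omega>) (Suc n))) \<omega>) \<in> M \<rightarrow>\<^sub>M count_space UNIV" for n
    by simp
  have "eta_est \<P> (\<lambda>n. X n \<omega>) (\<lambda>n. Y n \<omega>) k
      = 1 / real k * (\<Sum>n<k. real (Y (- int (tau_seq \<P> (\<lambda>n. X n \<omega>) (\<lambda>n. Y n \<omega>) (Suc n))) \<omega>))" for \<omega>
    by (simp add: eta_est_def sum.atLeast1_atMost_eq)
  then show ?thesis
    unfolding g_est_def by simp
qed

theorem cond_error_tendsto_bayes:
  "AE \<omega> in M.
    (\<lambda>k. prob_given M past (\<lambda>\<omega>. g_est \<P> (\<lambda>n. X n \<omega>) (\<lambda>n. Y n \<omega>) k \<noteq> Y 0 \<omega>) \<omega>)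
    \<longlonglongrightarrow> prob_given M past (\<lambda>\<omega>. bayes_decision M X Y \<omega> \<noteq> Y 0 \<omega>) \<omega>"
proof -
  interpret P: sigma_finite_subalgebra M past
    by (rule sigma_finite_subalgebraI[OF subalgebra_past])
  define \<eta> where "\<eta> = real_cond_exp M past label"
  have decision_M[measurable]: "mean_decision k \<in> M \<rightarrow>\<^sub>M count_space UNIV" for k
    by (rule measurable_from_subalg[OF subalgebra_past mean_decision_past])
  have same: "AE \<omega> in M. prob_given M past (\<lambda>\<omega>. g_est \<P> (\<lambda>n. X n \<omega>) (\<lambda>n. Y n \<omega>) k \<noteq> Y 0 \<omega>) \<omega>
      = prob_given M past (\<lambda>\<omega>. mean_decision k \<omega> \<noteq> Y 0 \<omega>) \<omega>" for k
    unfolding prob_given_def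
  proof (rule P.real_cond_exp_cong)
    show "AE \<omega> in M. indicator {\<omega>\<in>space M. g_est \<P> (\<lambda>n. X n \<omega>) (\<lambda>n. Y n \<omega>) k \<noteq> Y 0 \<omega>} \<omega>
        = (indicator {\<omega>\<in>space M. mean_decision k \<omega> \<noteq> Y 0 \<omega>} \<omega> :: real)"
      using AE_recurrent_set
    proof eventually_elim
      case (elim \<omega>)
      then have "g_est \<P> (\<lambda>n. X n \<omega>) (\<lambda>n. Y n \<omega>) k = mean_decision k \<omega>"
        by (simp add: g_est_def mean_decision_def eta_est_eq_mean)
      then show ?case
        by (simp add: indicator_def)
    qed
  qed (rule borel_measurable_indicator error_event g_est_measurable decision_M)+
  have mean: "AE \<omega> in M. prob_given M past (\<lambda>\<omega>. mean_decision k \<omega> \<noteq> Y 0 \<omega>) \<omega>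
      = (if mean_decision k \<omega> = 1 then 1 - \<eta> \<omega> else \<eta> \<omega>)" for k
    unfolding \<eta>_def by (rule cond_error_prob[OF mean_decision_past]) (simp add: mean_decision_def)
  have est: "AE \<omega> in M. prob_given M past (\<lambda>\<omega>. g_est \<P> (\<lambda>n. X n \<omega>) (\<lambda>n. Y n \<omega>) k \<noteq> Y 0 \<omega>) \<omega>
      = (if mean_decision k \<omega> = 1 then 1 - \<eta> \<omega> else \<eta> \<omega>)" for k
    using same[of k] mean[of k] by eventually_elim simp
  have "AE \<omega> in M. \<forall>k. prob_given M past (\<lambda>\<omega>. g_est \<P> (\<lambda>n. X n \<omega>) (\<lambda>n. Y n \<omega>) k \<noteq> Y 0 \<omega>) \<omega>
      = (if mean_decision k \<omega> = 1 then 1 - \<eta> \<omega> else \<eta> \<omega>)"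
    unfolding AE_all_countable using est by blast
  moreover have "AE \<omega> in M. prob_given M past (\<lambda>\<omega>. bayes_decision M X Y \<omega> \<noteq> Y 0 \<omega>) \<omega>
      = (if bayes_decision M X Y \<omega> = 1 then 1 - \<eta> \<omega> else \<eta> \<omega>)"
    unfolding \<eta>_def by (rule cond_error_prob[OF bayes_decision_past]) (simp add: bayes_decision_def)
  moreover have "AE \<omega> in M. (\<lambda>k. (\<Sum>n<k. matched_label n \<omega>) / real k) \<longlonglongrightarrow> \<eta> \<omega>"
    unfolding \<eta>_def by (rule mean_matched_label_tendsto)
  ultimately show ?thesis
  proof eventually_elim
    case (elim \<omega>)
    have bayes: "bayes_decision M X Y \<omega> = (if \<eta> \<omega> \<ge> 1 / 2 then 1 else 0)"
      by (simp add: bayes_decision_def prob_given_def \<eta>_def)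
    consider "\<eta> \<omega> > 1 / 2" | "\<eta> \<omega> = 1 / 2" | "\<eta> \<omega> < 1 / 2" by linarith
    then have "\<forall>\<^sub>F k in sequentially. (if mean_decision k \<omega> = 1 then 1 - \<eta> \<omega> else \<eta> \<omega>)
        = (if bayes_decision M X Y \<omega> = 1 then 1 - \<eta> \<omega> else \<eta> \<omega>)"
    proof cases
      case 1
      from order_tendstoD(1)[OF elim(3) 1] show ?thesis
        by eventually_elim (use 1 in \<open>simp add: mean_decision_def bayes\<close>)
    next
      case 2
      then show ?thesis by simp
    next
      case 3
      from order_tendstoD(2)[OF elim(3) 3] show ?thesis
        by eventually_elim (use 3 in \<open>simp add: mean_decision_def bayes\<close>)
    qed
    then show ?case
      using elim(1,2) by (auto intro: tendsto_eventually)
  qed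
qed

end

theorem corollary2:
  fixes M :: "'w measure"
    and X :: "int \<Rightarrow> 'w \<Rightarrow> real ^ 'd"
    and Y :: "int \<Rightarrow> 'w \<Rightarrow> nat"
    and \<P> :: "nat \<Rightarrow> (real ^ 'd) set set"
  assumes "prob_space M"
    and "stationary_process M obs_space (\<lambda>n \<omega>. (X n \<omega>, Y n \<omega>))"
    and "ergodic_process M obs_space (\<lambda>n \<omega>. (X n \<omega>, Y n \<omega>))"
    and "rectangle_partitions \<P>"
  shows "AE \<omega> in M.
    (\<lambda>k. prob_given M (past_algebra M X Y)
           (\<lambda>\<omega>. g_est \<P> (\<lambda>n. X n \<omega>) (\<lambda>n. Y n \<omega>) k \<noteq> Y 0 \<omega>) \<omega>)
    \<longlonglongrightarrow> prob_given M (past_algebra M X Y) (\<lambda>\<omega>. bayes_decision M X Y \<omega> \<noteq> Y 0 \<omega>) \<omega>"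
proof -
  interpret prob_space M by (rule assms(1))
  interpret quantized_process \<P> M X Y
    by unfold_locales (use assms(2,4) in \<open>auto simp: rectangle_partitions_def\<close>)
  show ?thesis
    by (rule cond_error_tendsto_bayes)
qed

end
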